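(* Let $X_1,X_2$ be independent real-valued continuous random variables such that, for $k=1,2$, $X_k$ has a PDF $f_k$ of the three-segment form with tail degree $N_k$, $n_k$ intermediate subintervals and partition points $q_{k,0}<\dots<q_{k,n_k}$. Let $X=X_1\odot X_2$ denote either their maximum $\max\{X_1,X_2\}$ or their sum $X_1+X_2$, and let $F$ be the CDF of $X$. Then there exists a family $\{f_{N,n}\}$, each element $f_{N,n}$ of which is a PDF of the three-segment form with tail degree $N$ and $n$ intermediate subintervals, such that $$\lim_{n,N\to\infty}\Big\Vert F(x)-\int_{-\infty}^{x}f_{N,n}(t)\,\mathrm{d}t\Big\Vert_{L^2(\mathbb{R})}=0$$ and $$\lim_{n,N\to\infty}\Big(F(x)-\int_{-\infty}^{x}f_{N,n}(t)\,\mathrm{d}t\Big)=0\qquad\text{for all }x\in\mathbb{R}.$$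
   Context: Notation: $\phi(t;\mu,\sigma)=\frac{1}{\sqrt{2\pi}\,\sigma}e^{-(t-\mu)^2/(2\sigma^2)}$ for $\mu\in\mathbb{R}$, $\sigma>0$. PDF = probability density function, CDF = cumulative distribution function. Three-segment form, with tail degree $N$, $n$ intermediate subintervals and partition points $q_0<q_1<\dots<q_n$: $$f(t)=\begin{cases}\sum_{j=0}^N c_j^{(l)}t^j\,\phi(t;\mu^{(l)},\sigma^{(l)}), & t\le q_0,\\ P_i, & q_{i-1}\le t<q_i,\ i=1,\dots,n,\\ \sum_{j=0}^N c_j^{(r)}t^j\,\phi(t;\mu^{(r)},\sigma^{(r)}), & t\ge q_n,\end{cases}$$ where $c_j^{(l)},c_j^{(r)},\mu^{(l)},\mu^{(r)}\in\mathbb{R}$ and $\sigma^{(l)},\sigma^{(r)}>0$ are parameters, the partition points are equally spaced, $q_i-q_{i-1}=(q_n-q_0)/n$, and each $P_i$ is a real constant (piecewise constant intermediate segment). The value at the single point $t=q_0$ is given by the first line. For $f_k$ all parameters carry an additional index $k$. The form by itself does not enforce non-negativity; in the convergence analysis attention is restricted to the case where $f$ is a valid probability density function. Convention on endpoints: for the approximating densities $f_{N,n}$ of $X$, the endpoints $q_0$ and $q_n$ are fixed (independent of $N$ and $n$; $q_n$ denotes the fixed right endpoint) and are quantiles of $X$ at two prescribed CDF levels $\varepsilon$ and $1-\varepsilon$, i.e. $F(q_0)=\varepsilon$ and $F(q_n)=1-\varepsilon$ with $0<\varepsilon<1/2$. *)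

theory Defs
  imports "HOL-Probability.Probability"
begin

text \<open>A probability density function on the real line. Non-negativity is required everywhere;
  for functions of the three-segment form below this is the same as almost everywhere.\<close>

definition is_pdf :: "(real \<Rightarrow> real) \<Rightarrow> bool" where
  "is_pdf f \<longleftrightarrow>
     f \<in> borel_measurable borel \<and> (\<forall>t. 0 \<le> f t) \<and> (\<integral>\<^sup>+ t. ennreal (f t) \<partial>lborel) = 1"

definition gauss_poly :: "nat \<Rightarrow> (nat \<Rightarrow> real) \<Rightarrow> real \<Rightarrow> real \<Rightarrow> real \<Rightarrow> real" where
  "gauss_poly N c \<mu> \<sigma> t = (\<Sum>j\<le>N. c j * t ^ j * normal_density \<mu> \<sigma> t)"

text \<open>Only the values \<open>q 0, \<dots>, q n\<close> and \<open>P 1, \<dots>, P n\<close> matter. The guard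
  \<open>q 0 < t\<close> in the middle segment leaves the value at \<open>t = q 0\<close> to the left tail.
  Leading coefficients may vanish, so \<open>N\<close> bounds the degree of the tails.\<close>

definition three_segment_form :: "nat \<Rightarrow> nat \<Rightarrow> (nat \<Rightarrow> real) \<Rightarrow> (real \<Rightarrow> real) \<Rightarrow> bool" where
  "three_segment_form N n q f \<longleftrightarrow>
     1 \<le> n \<and>
     (\<forall>i\<in>{1..n}. q (i - 1) < q i) \<and>
     (\<forall>i\<in>{1..n}. q i - q (i - 1) = (q n - q 0) / real n) \<and>
     (\<exists>cl \<mu>l \<sigma>l cr \<mu>r \<sigma>r P.
        0 < \<sigma>l \<and> 0 < \<sigma>r \<and>
        (\<forall>t. t \<le> q 0 \<longrightarrow> f t = gauss_poly N cl \<mu>l \<sigma>l t) \<and>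
        (\<forall>i\<in>{1..n}. \<forall>t. q 0 < t \<and> q (i - 1) \<le> t \<and> t < q i \<longrightarrow> f t = P i) \<and>
        (\<forall>t. q n \<le> t \<longrightarrow> f t = gauss_poly N cr \<mu>r \<sigma>r t))"

text \<open>The norm takes the value \<open>\<infinity>\<close> on functions that are not square integrable (a
  real-valued Bochner integral would give them norm 0).\<close>

definition L2_norm :: "(real \<Rightarrow> real) \<Rightarrow> ennreal" where
  "L2_norm g =
     (let I = \<integral>\<^sup>+ x. ennreal ((g x)\<^sup>2) \<partial>lborel
      in if I = \<infinity> then \<infinity> else ennreal (sqrt (enn2real I)))"

end

theory Submission imports Defs begin

text \<open>On the middle segment take \<open>P i\<close> to be the exact mean density of \<open>X\<close> over the \<open>i\<close>-th
  subinterval: the approximating CDF then agrees with \<open>F\<close> at all partition points, and since both are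
  monotone the error is at most the oscillation of the continuous function \<open>F\<close> on a subinterval.

  For a tail with survival function \<open>G\<close>, as a function of the distance \<open>y\<close> to the endpoint, apply the
  truncated Szasz--Mirakyan operator to \<open>u \<mapsto> G (sqrt (2 * u))\<close>:
  \<open>B y = (\<Sum>k\<le>M. G (sqrt (2 * v * k)) * exp (- y\<^sup>2 / (2 * v)) * (y\<^sup>2 / (2 * v)) ^ k / fact k)\<close>.
  Then \<open>- B'\<close> is a polynomial times a Gaussian, non-negative because \<open>G\<close> decreases, and it has exactly the
  right mass \<open>B 0 = G 0\<close>. As \<open>v \<longrightarrow> 0\<close> and \<open>v * M \<longrightarrow> \<infinity>\<close>, Chebyshev's inequality for the Poisson
  distribution gives \<open>B \<longrightarrow> G\<close> pointwise. The second moment of \<open>X\<close> is finite, so that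
  \<open>G y \<le> C / (1 + y\<^sup>2)\<close>; the operator preserves this bound up to a constant, and dominated convergence
  gives the convergence in \<open>L\<^sup>2\<close>.\<close>

section \<open>The Szasz--Mirakyan operator\<close>

definition poisson_weight :: "real \<Rightarrow> nat \<Rightarrow> real" where
  "poisson_weight l k = exp (- l) * l ^ k / fact k"

lemma poisson_weight_nonneg: "0 \<le> l \<Longrightarrow> 0 \<le> poisson_weight l k"
  by (simp add: poisson_weight_def)

text \<open>The recurrence from which the mean, the variance and the decay bound of the operator all
  follow by an index shift.\<close>

lemma poisson_weight_Suc: "real (Suc k) * poisson_weight l (Suc k) = l * poisson_weight l k"
  by (simp add: poisson_weight_def field_simps del: of_nat_Suc)

lemma poisson_weight_sums: "poisson_weight l sums 1"
proof -
  have "(\<lambda>k. exp (- l) * (l ^ k /\<^sub>R fact k)) sums (exp (- l) * exp l)"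
    by (intro sums_mult exp_converges)
  then show ?thesis
    by (simp add: poisson_weight_def[abs_def] exp_minus divide_inverse mult_ac)
qed

lemma poisson_weight_mean: "(\<lambda>k. real k * poisson_weight l k) sums l"
proof -
  have "(\<lambda>k. real (Suc k) * poisson_weight l (Suc k)) sums (l * 1)"
    unfolding poisson_weight_Suc by (intro sums_mult poisson_weight_sums)
  then show ?thesis
    by (subst (asm) sums_Suc_iff) simp
qed

text \<open>Applying the recurrence and then the mean gives the second factorial moment
  \<open>l * l\<close>. The rest is the decomposition (k - l)^2 = k (k - 1) + (1 - 2 l) k +
  l^2.\<close>

lemma poisson_weight_variance: "(\<lambda>k. (real k - l)\<^sup>2 * poisson_weight l k) sums l"
proof -
  have "real (Suc k) * (real (Suc k) - 1) * poisson_weight l (Suc k) = l * (real k * poisson_weight l k)" for k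
    using arg_cong[OF poisson_weight_Suc[of k l], of "\<lambda>x. real k * x"] by (simp add: mult_ac)
  then have "(\<lambda>k. real (Suc k) * (real (Suc k) - 1) * poisson_weight l (Suc k)) sums (l * l)"
    by (simp only:) (intro sums_mult poisson_weight_mean)
  then have *: "(\<lambda>k. real k * (real k - 1) * poisson_weight l k) sums (l * l)"
    by (subst (asm) sums_Suc_iff) simp
  have "(\<lambda>k. real k * (real k - 1) * poisson_weight l k
      + (1 - 2 * l) * (real k * poisson_weight l k) + l\<^sup>2 * poisson_weight l k) sums
      (l * l + (1 - 2 * l) * l + l\<^sup>2 * 1)"
    by (intro sums_add sums_mult * poisson_weight_mean poisson_weight_sums)
  then show ?thesis
    by (simp add: algebra_simps power2_eq_square)
qed

lemma sum_poisson_weight_le_1: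
  assumes "0 \<le> l"
  shows "(\<Sum>k\<le>M. poisson_weight l k) \<le> 1"
  using sum_le_suminf[of "poisson_weight l" "{..M}"] poisson_weight_sums[of l]
  by (auto simp: sums_iff poisson_weight_nonneg[OF assms])

text \<open>The case distinction matters: at \<open>k = 0\<close> the truncated difference
  \<open>k - 1\<close> would wrongly produce the weight of 0 again.\<close>

lemma DERIV_poisson_weight:
  "((\<lambda>l. poisson_weight l k) has_real_derivative
     ((if k = 0 then 0 else poisson_weight l (k - 1)) - poisson_weight l k)) (at l)"
proof (cases k)
  case 0
  then show ?thesis
    unfolding poisson_weight_def by (auto intro!: derivative_eq_intros)
next
  case (Suc j)
  show ?thesis
    unfolding poisson_weight_def Suc
    by (rule derivative_eq_intros refl | simp del: of_nat_Suc add: field_simps)+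
qed

text \<open>Abel summation moves the difference from the weights to the coefficients. Truncation
  acts as if \<open>c (Suc M)\<close> were 0, so the last coefficient is \<open>c M\<close> itself.
  For decreasing non-negative \<open>c\<close> every coefficient in the bracket is
  non-negative.\<close>

lemma DERIV_sum_poisson_weight:
  "((\<lambda>l. \<Sum>k\<le>M. c k * poisson_weight l k) has_real_derivative
     - (\<Sum>k\<le>M. (c k - (if k = M then 0 else c (Suc k))) * poisson_weight l k)) (at l)"
proof -
  have "(\<Sum>k\<le>M. c k * ((if k = 0 then 0 else poisson_weight l (k - 1)) - poisson_weight l k))
      = - (\<Sum>k<M. (c k - c (Suc k)) * poisson_weight l k) - c M * poisson_weight l M"
    by (induction M) (auto simp: algebra_simps lessThan_Suc)
  also have "\<dots> = - (\<Sum>k\<le>M. (c k - (if k = M then 0 else c (Suc k))) * poisson_weight l k)"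
    by (simp add: lessThan_Suc_atMost[symmetric])
  finally show ?thesis
    using DERIV_sum[of "{..M}" "\<lambda>l k. c k * poisson_weight l k", OF DERIV_cmult[OF DERIV_poisson_weight], of l]
    by (simp only:)
qed

lemma poisson_weight_at_top: "((\<lambda>l. poisson_weight l k) \<longlongrightarrow> 0) at_top"
proof -
  have "((\<lambda>l::real. l ^ k / exp l / fact k) \<longlongrightarrow> 0 / fact k) at_top" for k
    by (rule tendsto_divide[OF tendsto_power_div_exp_0 tendsto_const]) simp
  then show ?thesis
    by (simp add: poisson_weight_def[abs_def] exp_minus field_simps)
qed

text \<open>The operator with parameter \<open>1 / v\<close>, truncated after \<open>M\<close> terms.\<close>

definition szasz :: "nat \<Rightarrow> real \<Rightarrow> (real \<Rightarrow> real) \<Rightarrow> real \<Rightarrow> real" where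
  "szasz M v h u = (\<Sum>k\<le>M. h (v * real k) * poisson_weight (u / v) k)"

lemma szasz_nonneg:
  assumes "0 < v" "0 \<le> u" "\<And>w. 0 \<le> w \<Longrightarrow> 0 \<le> h w"
  shows "0 \<le> szasz M v h u"
  unfolding szasz_def using assms
  by (intro sum_nonneg mult_nonneg_nonneg poisson_weight_nonneg) auto

text \<open>The Poisson law with parameter 0 is concentrated at \<open>k = 0\<close>. This exactness
  gives the approximating tails the right total mass.\<close>

lemma szasz_at_0: "szasz M v h 0 = h 0"
proof -
  have "szasz M v h 0 = (\<Sum>k\<le>M. if k = 0 then h 0 else 0)"
    unfolding szasz_def by (intro sum.cong) (auto simp: poisson_weight_def)
  then show ?thesis by simp
qed

text \<open>Two bounds are added. The weights sum to at most 1, so the operator is at most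
  \<open>C\<close>. Multiplied by \<open>u\<close> it is again at most \<open>C\<close>: the
  recurrence turns \<open>l * poisson_weight l k\<close> into the next weight times
  \<open>Suc k\<close>, and \<open>v \<le> 1\<close> lets \<open>v * real (Suc k)\<close> replace
  the larger denominator \<open>1 + v * real k\<close>.\<close>

lemma szasz_decay:
  assumes v: "0 < v" "v \<le> 1" and u: "0 \<le> u" and C: "0 \<le> C"
    and h: "\<And>w. 0 \<le> w \<Longrightarrow> h w \<le> C / (1 + w)"
  shows "szasz M v h u \<le> 2 * C / (1 + u)"
proof -
  define l where "l = u / v"
  have l: "0 \<le> l" "u = v * l" using v u by (auto simp: l_def)
  have "h (v * real k) * poisson_weight l k \<le> C * poisson_weight l k" for k
  proof -
    have "h (v * real k) \<le> C / (1 + v * real k)" using h v by simp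
    also have "\<dots> \<le> C / 1" using v C by (intro divide_left_mono) (auto intro: add_pos_nonneg)
    finally show ?thesis using l by (intro mult_right_mono poisson_weight_nonneg) auto
  qed
  then have "szasz M v h u \<le> (\<Sum>k\<le>M. C * poisson_weight l k)"
    unfolding szasz_def l_def by (intro sum_mono)
  also have "\<dots> \<le> C * 1"
    unfolding sum_distrib_left[symmetric] by (intro mult_left_mono sum_poisson_weight_le_1 l C)
  finally have 1: "szasz M v h u \<le> C" by simp
  have "u * (h (v * real k) * poisson_weight l k) \<le> C * poisson_weight l (Suc k)" for k
  proof -
    have "v * real (Suc k) \<le> 1 + v * real k" using v by (simp add: algebra_simps)
    then have "h (v * real k) \<le> C / (v * real (Suc k))"
      using h[of "v * real k"] v C
      by (intro order_trans[OF h divide_left_mono]) (auto simp del: of_nat_Suc intro!: mult_pos_pos add_pos_nonneg)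
    then have "u * (h (v * real k) * poisson_weight l k)
        \<le> u * (C / (v * real (Suc k)) * poisson_weight l k)"
      using u l by (intro mult_left_mono mult_right_mono poisson_weight_nonneg) auto
    also have "\<dots> = C * (l * poisson_weight l k) / real (Suc k)"
      unfolding l(2) using v by (simp add: divide_simps del: of_nat_Suc)
    also have "\<dots> = C * poisson_weight l (Suc k)"
      unfolding poisson_weight_Suc[symmetric] by (simp del: of_nat_Suc)
    finally show ?thesis .
  qed
  then have "u * szasz M v h u \<le> (\<Sum>k\<le>M. C * poisson_weight l (Suc k))"
    unfolding szasz_def l_def sum_distrib_left by (intro sum_mono)
  also have "\<dots> \<le> C * (\<Sum>k\<le>Suc M. poisson_weight l k)"
    unfolding sum_distrib_left[symmetric] sum.atMost_Suc_shift
    using l C by (intro mult_left_mono) (auto simp: poisson_weight_nonneg)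
  also have "\<dots> \<le> C * 1"
    by (intro mult_left_mono sum_poisson_weight_le_1 l C)
  finally show ?thesis
    using 1 u by (simp add: field_simps)
qed

text \<open>Extending \<open>h\<close> by 0 beyond the last node, as \<open>g\<close> does, makes
  the error a full Poisson expectation. Nodes near \<open>u\<close> contribute at most
  \<open>e\<close>. At the others the trivial bound 1 is at most the squared deviation over d^2,
  whose expectation is the variance term \<open>v * u / d\<^sup>2\<close>.\<close>

lemma szasz_error:
  assumes v: "0 < v" and u: "0 \<le> u" and d: "0 < d" "d \<le> 1" and e: "0 \<le> e"
    and M: "u + 1 \<le> v * real M"
    and h: "\<And>w. 0 \<le> w \<Longrightarrow> 0 \<le> h w" "\<And>w. 0 \<le> w \<Longrightarrow> h w \<le> 1"
    and close: "\<And>w. 0 \<le> w \<Longrightarrow> \<bar>w - u\<bar> < d \<Longrightarrow> \<bar>h w - h u\<bar> \<le> e"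
  shows "\<bar>szasz M v h u - h u\<bar> \<le> e + v * u / d\<^sup>2"
proof -
  define l where "l = u / v"
  define g where "g k = (if k \<le> M then h (v * real k) else 0)" for k
  have l: "0 \<le> l" "u = v * l" using v u by (auto simp: l_def)
  have "(\<lambda>k. g k * poisson_weight l k) sums (\<Sum>k\<le>M. g k * poisson_weight l k)"
    by (intro sums_finite) (auto simp: g_def)
  also have "(\<Sum>k\<le>M. g k * poisson_weight l k) = szasz M v h u"
    by (simp add: szasz_def g_def l_def)
  finally have "(\<lambda>k. g k * poisson_weight l k - h u * poisson_weight l k) sums
      (szasz M v h u - h u * 1)"
    by (intro sums_diff sums_mult poisson_weight_sums)
  then have S: "(\<lambda>k. (g k - h u) * poisson_weight l k) sums (szasz M v h u - h u)"
    by (simp add: algebra_simps)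
  have T: "(\<lambda>k. e * poisson_weight l k + v\<^sup>2 / d\<^sup>2 * ((real k - l)\<^sup>2 * poisson_weight l k)) sums
      (e * 1 + v\<^sup>2 / d\<^sup>2 * l)"
    by (intro sums_add sums_mult poisson_weight_sums poisson_weight_variance)
  have *: "\<bar>g k - h u\<bar> \<le> e + v\<^sup>2 / d\<^sup>2 * (real k - l)\<^sup>2" for k
  proof (cases "\<bar>v * real k - u\<bar> < d")
    case True
    \<comment> \<open>Truncation is not felt near \<open>u\<close>: nodes beyond \<open>M\<close>
      lie at least 1 above \<open>u\<close>, whereas \<open>d \<le> 1\<close>.\<close>
    have "k \<le> M"
    proof (rule ccontr)
      assume "\<not> k \<le> M"
      then have "v * real M \<le> v * real k" using v by (intro mult_left_mono) auto
      then show False using M True d by auto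
    qed
    then have "\<bar>g k - h u\<bar> \<le> e" using close[OF _ True] v by (simp add: g_def)
    then show ?thesis by (rule order_trans) simp
  next
    case False
    have "d\<^sup>2 \<le> (v * real k - u)\<^sup>2"
      using False d by (simp add: abs_le_square_iff[symmetric])
    also have "\<dots> = v\<^sup>2 * (real k - l)\<^sup>2"
      unfolding l(2) by (simp add: power_mult_distrib[symmetric] algebra_simps)
    finally have "1 \<le> v\<^sup>2 / d\<^sup>2 * (real k - l)\<^sup>2" using d by (simp add: field_simps)
    moreover have "0 \<le> g k" "g k \<le> 1" using h v by (auto simp: g_def)
    then have "\<bar>g k - h u\<bar> \<le> 1" using h[OF u] by (simp add: abs_le_iff)
    ultimately show ?thesis using e by simp
  qed
  have "\<bar>(g k - h u) * poisson_weight l k\<bar>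
      \<le> e * poisson_weight l k + v\<^sup>2 / d\<^sup>2 * ((real k - l)\<^sup>2 * poisson_weight l k)" for k
    using mult_right_mono[OF *[of k] poisson_weight_nonneg[OF l(1), of k]]
    by (simp only: abs_mult abs_of_nonneg[OF poisson_weight_nonneg[OF l(1)]] distrib_right mult.assoc)
  then have le: "(g k - h u) * poisson_weight l k
      \<le> e * poisson_weight l k + v\<^sup>2 / d\<^sup>2 * ((real k - l)\<^sup>2 * poisson_weight l k)"
    "- ((g k - h u) * poisson_weight l k)
      \<le> e * poisson_weight l k + v\<^sup>2 / d\<^sup>2 * ((real k - l)\<^sup>2 * poisson_weight l k)" for k
    by (meson abs_le_iff)+
  have "\<bar>szasz M v h u - h u\<bar> \<le> e * 1 + v\<^sup>2 / d\<^sup>2 * l"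
    using sums_le[OF le(1) S T] sums_le[OF le(2) sums_minus[OF S] T] by (simp add: abs_le_iff)
  also have "v\<^sup>2 / d\<^sup>2 * l = v * u / d\<^sup>2"
    unfolding l(2) by (simp add: power2_eq_square)
  finally show ?thesis by simp
qed

lemma szasz_tendsto:
  assumes v: "\<And>N. 0 < v N" "v \<longlonglongrightarrow> 0"
    and M: "filterlim (\<lambda>N. v N * real (M N)) at_top sequentially"
    and u: "0 \<le> u" and cont: "continuous_on {0..} h"
    and h: "\<And>w. 0 \<le> w \<Longrightarrow> 0 \<le> h w" "\<And>w. 0 \<le> w \<Longrightarrow> h w \<le> 1"
  shows "(\<lambda>N. szasz (M N) (v N) h u) \<longlonglongrightarrow> h u"
proof (rule tendstoI)
  fix e :: real assume e: "0 < e"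
  obtain d0 where d0: "0 < d0" "\<And>w. 0 \<le> w \<Longrightarrow> dist w u < d0 \<Longrightarrow> dist (h w) (h u) < e / 2"
    using cont u e unfolding continuous_on_iff
    by (metis atLeast_iff half_gt_zero)
  \<comment> \<open>Capped at 1, the margin by which the last node has to exceed \<open>u\<close> in
    \<open>szasz_error\<close>.\<close>
  define d where "d = min d0 1"
  have d: "0 < d" "d \<le> 1" using d0 by (auto simp: d_def)
  have close: "\<bar>h w - h u\<bar> \<le> e / 2" if "0 \<le> w" "\<bar>w - u\<bar> < d" for w
    using d0(2)[of w] that by (auto simp: d_def dist_real_def)
  have "(\<lambda>N. v N * (u / d\<^sup>2)) \<longlonglongrightarrow> 0 * (u / d\<^sup>2)" by (intro tendsto_mult v tendsto_const)
  then have "eventually (\<lambda>N. v N * (u / d\<^sup>2) < e / 2) sequentially"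
    using e by (intro order_tendstoD) auto
  moreover have "eventually (\<lambda>N. u + 1 \<le> v N * real (M N)) sequentially"
    using M by (simp add: filterlim_at_top)
  ultimately show "eventually (\<lambda>N. dist (szasz (M N) (v N) h u) (h u) < e) sequentially"
  proof eventually_elim
    case (elim N)
    have "\<bar>szasz (M N) (v N) h u - h u\<bar> \<le> e / 2 + v N * u / d\<^sup>2"
      using e by (intro szasz_error v u d elim h close) auto
    then show ?case
      using elim(1) unfolding dist_real_def times_divide_eq_right by linarith
  qed
qed

section \<open>Approximation of a tail\<close>

text \<open>\<open>B\<close> is the survival function of a one-sided tail, written as a function of the distance \<open>y \<ge> 0\<close>
  to the endpoint of the middle segment; both tails of the approximants have this shape.\<close>

definition gauss_tail :: "nat \<Rightarrow> real poly \<Rightarrow> real \<Rightarrow> (real \<Rightarrow> real) \<Rightarrow> bool" where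
  "gauss_tail N p \<sigma> B \<longleftrightarrow>
     degree p \<le> N \<and> 0 < \<sigma> \<and> (\<forall>y\<ge>0. 0 \<le> poly p y) \<and> (\<forall>y\<ge>0. 0 \<le> B y) \<and>
     B \<in> borel_measurable borel \<and>
     (\<forall>y\<ge>0. (\<integral>\<^sup>+s. ennreal (poly p s * normal_density 0 \<sigma> s) * indicator {y..} s \<partial>lborel) = ennreal (B y))"

text \<open>The sum is finite and each Poisson weight vanishes as its parameter grows. Truncation
  thus provides the limit 0 at infinity that a survival function must have.\<close>

lemma szasz_at_top:
  assumes "0 < v"
  shows "((\<lambda>y. szasz M v h (y\<^sup>2 / 2)) \<longlongrightarrow> 0) at_top"
proof -
  have "filterlim (\<lambda>y::real. y\<^sup>2 / 2 / v) at_top at_top"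
    using assms by real_asymp
  then have "((\<lambda>y. \<Sum>k\<le>M. h (v * real k) * poisson_weight (y\<^sup>2 / 2 / v) k) \<longlongrightarrow> (\<Sum>k\<le>M. h (v * real k) * 0)) at_top"
    by (intro tendsto_sum tendsto_mult_left filterlim_compose[OF poisson_weight_at_top])
  then show ?thesis by (simp add: szasz_def)
qed

text \<open>Substituting \<open>u = y\<^sup>2 / 2\<close>, minus the derivative of the operator is an odd polynomial in \<open>y\<close>
  times a Gaussian; Abel summation shows that its coefficients are increments of \<open>h\<close>.\<close>

lemma szasz_survival_function:
  assumes v: "0 < v"
    and anti: "\<And>x y. 0 \<le> x \<Longrightarrow> x \<le> y \<Longrightarrow> h y \<le> h x" and nonneg: "\<And>x. 0 \<le> x \<Longrightarrow> 0 \<le> h x"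
  obtains p :: "real poly" where "degree p \<le> 2 * M + 1" "\<And>y. 0 \<le> y \<Longrightarrow> 0 \<le> poly p y"
    "\<And>y. 0 \<le> y \<Longrightarrow> (\<integral>\<^sup>+x. ennreal (poly p x * normal_density 0 (sqrt v) x) * indicator {y..} x \<partial>lborel)
      = ennreal (szasz M v h (y\<^sup>2 / 2))"
proof
  define c where "c k = h (v * real k) - (if k = M then 0 else h (v * real (Suc k)))" for k
  have c: "0 \<le> c k" for k
    unfolding c_def using v by (auto intro!: anti nonneg simp del: of_nat_Suc)
  \<comment> \<open>The factor \<open>sqrt (2 * pi * v)\<close> cancels the normalisation of the
    Gaussian with variance \<open>v\<close>, \<open>fact k * (2 * v) ^ k\<close> comes from the
    Poisson weight at \<open>y\<^sup>2 / (2 * v)\<close>, and the extra \<open>y / v\<close> comes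
    from the chain rule.\<close>
  let ?p = "smult (sqrt (2 * pi * v)) (\<Sum>k\<le>M. monom (c k / (v * fact k * (2 * v) ^ k)) (2 * k + 1))"
  show "degree ?p \<le> 2 * M + 1"
    by (intro order_trans[OF degree_smult_le] degree_sum_le order_trans[OF degree_monom_le]) auto
  show "0 \<le> poly ?p y" if "0 \<le> y" for y
    using that v c by (auto simp: poly_sum poly_monom intro!: mult_nonneg_nonneg sum_nonneg)
  have eq: "poly ?p y * normal_density 0 (sqrt v) y
      = (\<Sum>k\<le>M. c k * poisson_weight (y\<^sup>2 / 2 / v) k) * (y / v)" for y
  proof -
    have "sqrt (2 * pi * v) * (c k / (v * fact k * (2 * v) ^ k) * y ^ (2 * k + 1)) * normal_density 0 (sqrt v) y
       = c k * poisson_weight (y\<^sup>2 / 2 / v) k * (y / v)" for k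
    proof -
      have "y ^ (2 * k + 1) = y * (2 * v) ^ k * (y\<^sup>2 / 2 / v) ^ k"
        using v by (simp add: power_mult power_divide power_mult_distrib)
      moreover have "y ^ (k * 2) = (y\<^sup>2) ^ k"
        by (simp add: power_mult mult.commute[of k])
      ultimately show ?thesis
        using v by (simp add: normal_density_def poisson_weight_def field_simps)
    qed
    then show ?thesis
      by (simp only: poly_smult poly_sum poly_monom sum_distrib_left sum_distrib_right)
  qed
  show "(\<integral>\<^sup>+x. ennreal (poly ?p x * normal_density 0 (sqrt v) x) * indicator {y..} x \<partial>lborel)
      = ennreal (szasz M v h (y\<^sup>2 / 2))" if y: "0 \<le> y" for y
  proof -
    have "(\<integral>\<^sup>+x. ennreal (poly ?p x * normal_density 0 (sqrt v) x) * indicator {y..} x \<partial>lborel)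
        = ennreal (- 0 - - szasz M v h (y\<^sup>2 / 2))"
    \<comment> \<open>The antiderivative is minus the operator, so the integral is its limit
      \<open>- 0\<close> less its value at \<open>y\<close>.\<close>
    proof (rule nn_integral_FTC_atLeast)
      show "(\<lambda>x. poly ?p x * normal_density 0 (sqrt v) x) \<in> borel_measurable borel"
        by (intro borel_measurable_times borel_measurable_continuous_onI continuous_intros
            borel_measurable_normal_density)
      show "((\<lambda>x. - szasz M v h (x\<^sup>2 / 2)) has_real_derivative poly ?p x * normal_density 0 (sqrt v) x) (at x)" for x
      proof -
        have "((\<lambda>x. x\<^sup>2 / 2 / v) has_real_derivative x / v) (at x)"
          using v by (auto intro!: derivative_eq_intros)
        from DERIV_minus[OF DERIV_chain2[OF DERIV_sum_poisson_weight[where M = M and c = "\<lambda>k. h (v * real k)"] this]]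
        show ?thesis
          unfolding eq unfolding szasz_def c_def by (simp del: of_nat_Suc)
      qed
      show "0 \<le> poly ?p x * normal_density 0 (sqrt v) x" if "y \<le> x" for x
        unfolding eq using y that v c by (intro mult_nonneg_nonneg sum_nonneg poisson_weight_nonneg) auto
      show "((\<lambda>x. - szasz M v h (x\<^sup>2 / 2)) \<longlongrightarrow> - 0) at_top"
        by (intro tendsto_minus szasz_at_top v)
    qed
    then show ?thesis by simp
  qed
qed

text \<open>Variance 1/2 turns the density into exp (- x^2) / sqrt pi, the integrand of
  \<open>gaussian_moment_0\<close>. This serves the tail of degree 0 below.\<close>

lemma nn_integral_half_normal:
  "(\<integral>\<^sup>+x. ennreal (normal_density 0 (1 / sqrt 2) x) * indicator {0..} x \<partial>lborel) = ennreal (1 / 2)"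
proof -
  have "has_bochner_integral lborel (\<lambda>x. (1 / sqrt pi) * (indicator {0..} x *\<^sub>R exp (- x\<^sup>2))) ((1 / sqrt pi) * (sqrt pi / 2))"
    by (intro has_bochner_integral_mult_right gaussian_moment_0)
  then have int: "integrable lborel (\<lambda>x. (1 / sqrt pi) * (indicator {0..} x *\<^sub>R exp (- x\<^sup>2)))"
    and eq: "(\<integral>x. (1 / sqrt pi) * (indicator {0..} x *\<^sub>R exp (- x\<^sup>2)) \<partial>lborel) = (1 / sqrt pi) * (sqrt pi / 2)"
    unfolding has_bochner_integral_iff by blast+
  have "(\<integral>\<^sup>+x. ennreal ((1 / sqrt pi) * (indicator {0..} x *\<^sub>R exp (- x\<^sup>2))) \<partial>lborel)
      = ennreal ((1 / sqrt pi) * (sqrt pi / 2))"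
    unfolding eq[symmetric] by (intro nn_integral_eq_integral int) simp
  also have "(1 / sqrt pi) * (sqrt pi / 2) = 1 / 2"
    by simp
  finally have "(\<integral>\<^sup>+x. ennreal ((1 / sqrt pi) * (indicator {0..} x *\<^sub>R exp (- x\<^sup>2))) \<partial>lborel) = ennreal (1 / 2)" .
  moreover have "(1 / sqrt pi) * (indicator {0..} x *\<^sub>R exp (- x\<^sup>2)) = normal_density 0 (1 / sqrt 2) x * indicator {0..} x" for x
    by (simp add: normal_density_def power_divide)
  ultimately show ?thesis
    by (simp add: ennreal_mult'' flip: ennreal_indicator)
qed

lemma nn_integral_inverse_1_plus_square_finite:
  "(\<integral>\<^sup>+x. ennreal (inverse (1 + x\<^sup>2)) \<partial>lborel) < \<infinity>" 
proof -
  have "integrable lborel (\<lambda>x::real. inverse (1 + x\<^sup>2))"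
    using integrable_inverse_1_plus_square by (simp add: set_integrable_def)
  then show ?thesis
    by (auto simp: integrable_iff_bounded abs_mult)
qed

text \<open>The substitution u = y^2 / 2 turns the decay of \<open>G\<close> into the decay in
  \<open>u\<close> that the operator preserves up to a constant. The tails built from the operator
  have degree bound \<open>2 * M + 1\<close>, which is never 0, so \<open>N = 0\<close> is served by
  a half-normal tail of the same mass.\<close>

lemma tail_approximation:
  fixes G :: "real \<Rightarrow> real"
  assumes anti: "\<And>x y. 0 \<le> x \<Longrightarrow> x \<le> y \<Longrightarrow> G y \<le> G x"
    and G: "\<And>y. 0 \<le> y \<Longrightarrow> 0 \<le> G y" "\<And>y. 0 \<le> y \<Longrightarrow> G y \<le> 1"
    and cont: "continuous_on UNIV G"
    and decay: "\<And>y. 0 \<le> y \<Longrightarrow> G y \<le> C / (1 + y\<^sup>2)"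
  obtains p :: "nat \<Rightarrow> real poly" and s :: "nat \<Rightarrow> real" and B :: "nat \<Rightarrow> real \<Rightarrow> real" where
    "\<And>N. gauss_tail N (p N) (s N) (B N)" "\<And>N. B N 0 = G 0"
    "\<And>y. 0 \<le> y \<Longrightarrow> (\<lambda>N. B N y) \<longlonglongrightarrow> G y"
    "(\<lambda>N. \<integral>\<^sup>+y. ennreal ((B N y - G y)\<^sup>2) * indicator {0..} y \<partial>lborel) \<longlonglongrightarrow> 0"
proof -
  define h where "h u = G (sqrt (2 * u))" for u
  \<comment> \<open>The mesh tends to 0 while \<open>v N * real (M N)\<close> still grows like half
    of \<open>sqrt N\<close>, so the nodes eventually reach past every point.\<close>
  define v where "v N = 1 / sqrt (real N + 1)" for N :: nat
  \<comment> \<open>For \<open>N \<ge> 1\<close> this is the largest \<open>M\<close> with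
    \<open>2 * M + 1 \<le> N\<close>.\<close>
  define M where "M N = (N - 1) div 2" for N :: nat
  have v: "0 < v N" "v N \<le> 1" for N by (auto simp: v_def)
  have v0: "v \<longlonglongrightarrow> 0" unfolding v_def by real_asymp
  have vM: "filterlim (\<lambda>N. v N * real (M N)) at_top sequentially"
  proof (rule filterlim_at_top_mono)
    show "filterlim (\<lambda>N. v N * (real N / 2 - 1)) at_top sequentially"
      unfolding v_def by real_asymp
    have "real N / 2 - 1 \<le> real (M N)" for N
      unfolding M_def by linarith
    then show "eventually (\<lambda>N. v N * (real N / 2 - 1) \<le> v N * real (M N)) sequentially"
      using v by (intro always_eventually allI mult_left_mono) (auto intro: less_imp_le)
  qed
  have h: "0 \<le> h u" "h u \<le> 1" if "0 \<le> u" for u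
    using that G by (auto simp: h_def)
  have h_anti: "h y \<le> h x" if "0 \<le> x" "x \<le> y" for x y
    using that by (auto simp: h_def intro!: anti)
  have h_cont: "continuous_on {0..} h"
    unfolding h_def by (intro continuous_on_compose2[OF cont] continuous_intros) auto
  have h_sq: "h (y\<^sup>2 / 2) = G y" if "0 \<le> y" for y
    using that by (simp add: h_def)
  have C: "0 \<le> C" using G(1)[of 0] decay[of 0] by simp
  have h_decay: "h u \<le> C / (1 + u)" if "0 \<le> u" for u
  proof -
    have "h u \<le> C / (1 + 2 * u)" using decay[of "sqrt (2 * u)"] that by (simp add: h_def)
    also have "\<dots> \<le> C / (1 + u)" using that C by (intro divide_left_mono) (auto intro!: mult_pos_pos)
    finally show ?thesis .
  qed
  have "\<exists>p. degree p \<le> 2 * M N + 1 \<and> (\<forall>y\<ge>0. 0 \<le> poly p y) \<and>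
      (\<forall>y\<ge>0. (\<integral>\<^sup>+x. ennreal (poly p x * normal_density 0 (sqrt (v N)) x) * indicator {y..} x \<partial>lborel)
        = ennreal (szasz (M N) (v N) h (y\<^sup>2 / 2)))" for N
  proof -
    obtain p where "degree p \<le> 2 * M N + 1" "\<And>y. 0 \<le> y \<Longrightarrow> 0 \<le> poly p y"
      "\<And>y. 0 \<le> y \<Longrightarrow> (\<integral>\<^sup>+x. ennreal (poly p x * normal_density 0 (sqrt (v N)) x) * indicator {y..} x \<partial>lborel)
        = ennreal (szasz (M N) (v N) h (y\<^sup>2 / 2))"
      using szasz_survival_function[of "v N" h "M N", OF v(1) h_anti h(1)] by blast
    then show ?thesis by (intro exI[of _ p] conjI allI impI)
  qed
  then have "\<exists>P. \<forall>N. degree (P N) \<le> 2 * M N + 1 \<and> (\<forall>y\<ge>0. 0 \<le> poly (P N) y) \<and>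
      (\<forall>y\<ge>0. (\<integral>\<^sup>+x. ennreal (poly (P N) x * normal_density 0 (sqrt (v N)) x) * indicator {y..} x \<partial>lborel)
        = ennreal (szasz (M N) (v N) h (y\<^sup>2 / 2)))"
    by (intro choice allI)
  then obtain P where P: "\<And>N. degree (P N) \<le> 2 * M N + 1" "\<And>N y. 0 \<le> y \<Longrightarrow> 0 \<le> poly (P N) y"
    "\<And>N y. 0 \<le> y \<Longrightarrow>
      (\<integral>\<^sup>+x. ennreal (poly (P N) x * normal_density 0 (sqrt (v N)) x) * indicator {y..} x \<partial>lborel)
        = ennreal (szasz (M N) (v N) h (y\<^sup>2 / 2))"
    by blast
  \<comment> \<open>The survival function of the tail for \<open>N = 0\<close>. The factor 2 offsets
    the mass 1/2 of the Gaussian on the half-line.\<close>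
  define I0 where "I0 y = (\<integral>\<^sup>+x. ennreal (poly [:2 * G 0:] x * normal_density 0 (1 / sqrt 2) x) * indicator {y..} x \<partial>lborel)" for y
  have I00: "I0 0 = ennreal (G 0)"
  proof -
    have "I0 0 = (\<integral>\<^sup>+x. ennreal (2 * G 0) * (ennreal (normal_density 0 (1 / sqrt 2) x) * indicator {0..} x) \<partial>lborel)"
      unfolding I0_def using G(1)[of 0] by (intro nn_integral_cong) (simp add: ennreal_mult mult_ac)
    also have "\<dots> = ennreal (2 * G 0) * ennreal (1 / 2)"
      by (simp add: nn_integral_cmult nn_integral_half_normal)
    also have "\<dots> = ennreal (G 0)"
      using G(1)[of 0] by (subst ennreal_mult[symmetric]) simp_all
    finally show ?thesis .
  qed
  have I0: "I0 y < \<infinity>" if "0 \<le> y" for y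
  proof -
    have "I0 y \<le> I0 0"
      unfolding I0_def using that by (intro nn_integral_mono) (auto split: split_indicator)
    then show ?thesis unfolding I00 by (rule le_less_trans) simp
  qed
  define p where "p N = (if N = 0 then [:2 * G 0:] else P N)" for N
  define s where "s N = (if N = 0 then 1 / sqrt 2 else sqrt (v N))" for N
  define B where "B N y = (if N = 0 then enn2real (I0 y) else szasz (M N) (v N) h (y\<^sup>2 / 2))" for N y
  have B_bound: "B (Suc N) y \<le> 4 * C / (1 + y\<^sup>2)" for N y
  proof -
    have "B (Suc N) y \<le> 2 * C / (1 + y\<^sup>2 / 2)"
      unfolding B_def using v C h_decay by (auto intro!: szasz_decay)
    also have "\<dots> \<le> 2 * C / ((1 + y\<^sup>2) / 2)"
      using C by (intro divide_left_mono) (auto intro!: mult_pos_pos add_pos_nonneg)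
    finally show ?thesis by simp
  qed
  have B_nonneg: "0 \<le> B N y" for N y
    using v h by (auto simp: B_def intro!: szasz_nonneg)
  have B_lim: "(\<lambda>N. B N y) \<longlonglongrightarrow> G y" if "0 \<le> y" for y
  proof -
    have "(\<lambda>N. szasz (M N) (v N) h (y\<^sup>2 / 2)) \<longlonglongrightarrow> h (y\<^sup>2 / 2)"
      by (intro szasz_tendsto v v0 vM h_cont h) auto
    from LIMSEQ_Suc[OF this] have "(\<lambda>N. B (Suc N) y) \<longlonglongrightarrow> G y"
      by (simp add: h_sq[OF that] B_def)
    then show ?thesis by (rule LIMSEQ_imp_Suc)
  qed
  have [measurable]: "G \<in> borel_measurable borel"
    using cont by (rule borel_measurable_continuous_onI)
  have B_meas [measurable]: "B N \<in> borel_measurable borel" for N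
  proof -
    have "I0 = (\<lambda>y. \<integral>\<^sup>+x. ennreal (2 * G 0 * normal_density 0 (1 / sqrt 2) x) * (if y \<le> x then 1 else 0) \<partial>lborel)"
      unfolding I0_def by (intro ext nn_integral_cong) (simp add: indicator_def)
    also have "\<dots> \<in> borel_measurable borel"
      by measurable
    finally have [measurable]: "I0 \<in> borel_measurable borel" .
    show ?thesis
      unfolding B_def szasz_def poisson_weight_def by (cases "N = 0") simp_all
  qed
  \<comment> \<open>The tail for \<open>N = 0\<close> is skipped, since \<open>B_bound\<close>
    concerns the operator only. The shift does not affect the limit.\<close>
  have "(\<lambda>N. \<integral>\<^sup>+y. ennreal ((B (Suc N) y - G y)\<^sup>2) * indicator {0..} y \<partial>lborel)
      \<longlonglongrightarrow> (\<integral>\<^sup>+(y::real). 0 \<partial>lborel)"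
  proof (rule nn_integral_dominated_convergence)
    show "(\<integral>\<^sup>+y. ennreal ((4 * C)\<^sup>2) * ennreal (inverse (1 + y\<^sup>2)) \<partial>lborel) < \<infinity>"
      using nn_integral_inverse_1_plus_square_finite
      by (simp add: nn_integral_cmult ennreal_mult_less_top)
    have "ennreal ((B (Suc N) y - G y)\<^sup>2) * indicator {0..} y
        \<le> ennreal ((4 * C)\<^sup>2) * ennreal (inverse (1 + y\<^sup>2))" for N y
    proof (cases "0 \<le> y")
      case True
      have "\<bar>B (Suc N) y - G y\<bar> \<le> 4 * C / (1 + y\<^sup>2)"
      proof -
        have "G y \<le> 4 * C / (1 + y\<^sup>2)"
          using decay[OF True] C by (rule_tac order_trans) (auto intro!: divide_right_mono)
        then show ?thesis
          using B_bound[of N y] B_nonneg[of "Suc N" y] G(1)[OF True] by (simp add: abs_le_iff)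
      qed
      then have "(B (Suc N) y - G y)\<^sup>2 \<le> (4 * C / (1 + y\<^sup>2))\<^sup>2"
        by (rule abs_le_square_iff[THEN iffD1, OF order_trans]) (use C in simp)
      also have "\<dots> = (4 * C)\<^sup>2 * (inverse (1 + y\<^sup>2) * inverse (1 + y\<^sup>2))"
        by (simp add: power2_eq_square divide_inverse mult_ac)
      \<comment> \<open>One of the two inverse factors is bounded by 1; the other remains as an
        integrable majorant.\<close>
      also have "\<dots> \<le> (4 * C)\<^sup>2 * (inverse (1 + y\<^sup>2) * 1)"
        using le_imp_inverse_le[of 1 "1 + y\<^sup>2"] by (intro mult_left_mono) simp_all
      finally show ?thesis
        using True by (simp flip: ennreal_mult' add: ennreal_leI)
    qed simp
    then show "AE y in lborel. ennreal ((B (Suc N) y - G y)\<^sup>2) * indicator {0..} y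
        \<le> ennreal ((4 * C)\<^sup>2) * ennreal (inverse (1 + y\<^sup>2))" for N
      by simp
    have "(\<lambda>N. ennreal ((B (Suc N) y - G y)\<^sup>2) * indicator {0..} y) \<longlonglongrightarrow> 0" for y
    proof (cases "0 \<le> y")
      case True
      have "(\<lambda>N. ennreal ((B (Suc N) y - G y)\<^sup>2)) \<longlonglongrightarrow> ennreal ((G y - G y)\<^sup>2)"
        by (intro tendsto_ennrealI tendsto_intros LIMSEQ_Suc B_lim True)
      with True show ?thesis by simp
    qed simp
    then show "AE y in lborel. (\<lambda>N. ennreal ((B (Suc N) y - G y)\<^sup>2) * indicator {0..} y) \<longlonglongrightarrow> 0"
      by simp
    show "(\<lambda>y. ennreal ((B (Suc N) y - G y)\<^sup>2) * indicator {0..} y) \<in> borel_measurable lborel" for N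
      by measurable
    show "(\<lambda>y. ennreal ((4 * C)\<^sup>2) * ennreal (inverse (1 + y\<^sup>2))) \<in> borel_measurable lborel"
      by measurable
  qed simp
  then have L2: "(\<lambda>N. \<integral>\<^sup>+y. ennreal ((B N y - G y)\<^sup>2) * indicator {0..} y \<partial>lborel) \<longlonglongrightarrow> 0"
    by (subst filterlim_sequentially_Suc[symmetric]) simp
  show ?thesis
  proof (rule that[of p s B])
    show "gauss_tail N (p N) (s N) (B N)" for N
      unfolding gauss_tail_def
    proof (intro conjI allI impI B_nonneg B_meas)
      show "degree (p N) \<le> N"
      proof (cases "N = 0")
        case False
        then have "2 * M N + 1 \<le> N" unfolding M_def by presburger
        with False P(1)[of N] show ?thesis by (simp add: p_def)
      qed (simp add: p_def)
      show "0 < s N" using v by (simp add: s_def)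
      show "0 \<le> poly (p N) y" if "0 \<le> y" for y
        using that P(2) G(1)[of 0] by (simp add: p_def)
      show "(\<integral>\<^sup>+x. ennreal (poly (p N) x * normal_density 0 (s N) x) * indicator {y..} x \<partial>lborel) = ennreal (B N y)"
        if "0 \<le> y" for y
      proof (cases "N = 0")
        case True
        then show ?thesis using I0[OF that] by (simp add: p_def s_def B_def I0_def)
      next
        case False
        then show ?thesis using P(3)[OF that, of N] by (simp add: p_def s_def B_def)
      qed
    qed
    show "B N 0 = G 0" for N
    proof (cases "N = 0")
      case True
      then show ?thesis using I00 G(1)[of 0] by (simp add: B_def)
    next
      case False
      then show ?thesis using szasz_at_0[of "M N" "v N" h] by (simp add: B_def h_def)
    qed
    show "(\<lambda>N. B N y) \<longlonglongrightarrow> G y" if "0 \<le> y" for y using that by (rule B_lim)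
    show "(\<lambda>N. \<integral>\<^sup>+y. ennreal ((B N y - G y)\<^sup>2) * indicator {0..} y \<partial>lborel) \<longlonglongrightarrow> 0"
      by (rule L2)
  qed
qed

section \<open>Moments and atoms\<close>

text \<open>Expanding the power of \<mu> + (t - \<mu>) binomially reduces the claim to central
  moments.\<close>

lemma integrable_power_normal_density:
  assumes "0 < \<sigma>"
  shows "integrable lborel (\<lambda>t. t ^ k * normal_density \<mu> \<sigma> t)"
proof -
  have "t ^ k * normal_density \<mu> \<sigma> t
      = (\<Sum>i\<le>k. (real (k choose i) * \<mu> ^ i) * (normal_density \<mu> \<sigma> t * (t - \<mu>) ^ (k - i)))" for t
    using binomial_ring[of \<mu> "t - \<mu>" k] by (simp add: sum_distrib_left mult_ac)
  then show ?thesis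
    by (simp only:) (intro Bochner_Integration.integrable_sum integrable_mult_right integrable_normal_moment assms)
qed

lemma integrable_gauss_poly_power:
  assumes "0 < \<sigma>"
  shows "integrable lborel (\<lambda>t. gauss_poly N c \<mu> \<sigma> t * t ^ k)"
proof -
  have "gauss_poly N c \<mu> \<sigma> t * t ^ k = (\<Sum>j\<le>N. c j * (t ^ (j + k) * normal_density \<mu> \<sigma> t))" for t
    by (simp add: gauss_poly_def sum_distrib_left sum_distrib_right power_add mult_ac)
  then show ?thesis
    by (simp only:) (intro Bochner_Integration.integrable_sum integrable_mult_right integrable_power_normal_density assms)
qed

lemma is_pdf_integrable:
  assumes "is_pdf f"
  shows "integrable lborel f"
  using assms by (auto simp: is_pdf_def intro!: integrableI_nonneg)

text \<open>On each tail \<open>f\<close> is a polynomial times a Gaussian. On the bounded middle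
  segment the power is at most \<open>K\<close>, so that \<open>K * f\<close> dominates. The sum of
  the three majorants is integrable.\<close>

lemma three_segment_integrable_power:
  assumes f: "is_pdf f" and form: "three_segment_form N n q f"
  shows "integrable lborel (\<lambda>t. f t * t ^ k)"
proof -
  obtain cl \<mu>l \<sigma>l cr \<mu>r \<sigma>r where \<sigma>: "0 < \<sigma>l" "0 < \<sigma>r"
    and l: "\<And>t. t \<le> q 0 \<Longrightarrow> f t = gauss_poly N cl \<mu>l \<sigma>l t"
    and r: "\<And>t. q n \<le> t \<Longrightarrow> f t = gauss_poly N cr \<mu>r \<sigma>r t"
    using form unfolding three_segment_form_def by blast
  define K where "K = (\<bar>q 0\<bar> + \<bar>q n\<bar>) ^ k"
  have nonneg: "0 \<le> f t" for t
    using f by (simp add: is_pdf_def)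
  have [measurable]: "f \<in> borel_measurable borel"
    using f by (simp add: is_pdf_def)
  show ?thesis
  proof (rule Bochner_Integration.integrable_bound)
    show "integrable lborel (\<lambda>t. \<bar>gauss_poly N cl \<mu>l \<sigma>l t * t ^ k\<bar> + \<bar>gauss_poly N cr \<mu>r \<sigma>r t * t ^ k\<bar> + K * f t)"
      by (intro Bochner_Integration.integrable_add integrable_abs integrable_mult_right
          integrable_gauss_poly_power \<sigma> is_pdf_integrable f)
    have "\<bar>f t * t ^ k\<bar> \<le> \<bar>gauss_poly N cl \<mu>l \<sigma>l t * t ^ k\<bar> + \<bar>gauss_poly N cr \<mu>r \<sigma>r t * t ^ k\<bar> + K * f t" for t
    proof -
      have K: "0 \<le> K * f t" using nonneg by (simp add: K_def)
      consider "t \<le> q 0" | "q n \<le> t" | "q 0 < t" "t < q n" by linarith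
      then show ?thesis
      proof cases
        case 3
        have "\<bar>t\<bar> ^ k \<le> K" unfolding K_def using 3 by (intro power_mono) auto
        then have "\<bar>f t * t ^ k\<bar> \<le> K * f t"
          using mult_right_mono[of "\<bar>t\<bar> ^ k" K, OF _ nonneg[of t]] nonneg[of t] by (simp add: abs_mult power_abs mult.commute)
        then show ?thesis by linarith
      qed (use K l r in auto)
    qed
    then show "AE t in lborel. norm (f t * t ^ k)
        \<le> norm (\<bar>gauss_poly N cl \<mu>l \<sigma>l t * t ^ k\<bar> + \<bar>gauss_poly N cr \<mu>r \<sigma>r t * t ^ k\<bar> + K * f t)"
      unfolding real_norm_def by (intro AE_I2 order_trans[OF _ abs_ge_self])
  qed measurable
qed

lemma (in prob_space) prob_distributed_lborel_singleton:
  fixes X :: "'a \<Rightarrow> real"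
  assumes X: "distributed M lborel X f"
  shows "prob {\<omega> \<in> space M. X \<omega> = x} = 0"
proof -
  have [measurable]: "f \<in> borel_measurable borel"
    using distributed_borel_measurable[OF X] by simp
  have "emeasure M (X -` {x} \<inter> space M) = (\<integral>\<^sup>+t. f t * indicator {x} t \<partial>lborel)"
    by (intro distributed_emeasure[OF X]) simp
  also have "\<dots> = (\<integral>\<^sup>+(t::real). 0 \<partial>lborel)"
    using AE_lborel_singleton[of x] by (intro nn_integral_cong_AE) auto
  also have "X -` {x} \<inter> space M = {\<omega> \<in> space M. X \<omega> = x}"
    by auto
  finally show ?thesis by (simp add: measure_def)
qed

text \<open>Chebyshev's inequality with 1 + y^2 in place of y^2, from integrating
  \<open>1 + (X \<omega> - c)\<^sup>2\<close> over the event. The bound stays finite at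
  \<open>y = 0\<close> and is square integrable in \<open>y\<close>.\<close>

lemma (in prob_space) prob_le_second_moment:
  assumes X: "integrable M (\<lambda>\<omega>. (X \<omega> - c)\<^sup>2)" and A: "A \<in> events"
    and y: "\<And>\<omega>. \<omega> \<in> A \<Longrightarrow> y\<^sup>2 \<le> (X \<omega> - c)\<^sup>2"
  shows "prob A \<le> (1 + expectation (\<lambda>\<omega>. (X \<omega> - c)\<^sup>2)) / (1 + y\<^sup>2)"
proof -
  have "(1 + y\<^sup>2) * prob A = (\<integral>\<omega>. (1 + y\<^sup>2) * indicator A \<omega> \<partial>M)"
    using A by simp
  also have "\<dots> \<le> (\<integral>\<omega>. 1 + (X \<omega> - c)\<^sup>2 \<partial>M)"
    using X A y by (intro integral_mono) (auto split: split_indicator simp: emeasure_eq_measure)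
  also have "\<dots> = 1 + expectation (\<lambda>\<omega>. (X \<omega> - c)\<^sup>2)"
    using X by (simp add: prob_space)
  finally show ?thesis
    by (simp add: field_simps add_pos_nonneg)
qed

text \<open>The second moment will give the decay of both tails, and the absence of atoms the
  continuity of the CDF. Atoms of the maximum are excluded by a union of two null events, those of
  the sum by the convolution density that independence provides.\<close>

lemma (in prob_space) max_or_sum_properties:
  fixes X1 X2 X :: "'a \<Rightarrow> real"
  assumes ind: "indep_var borel X1 borel X2"
    and f1: "is_pdf f1" "three_segment_form N1 n1 q1 f1"
    and X1: "distributed M lborel X1 (\<lambda>t. ennreal (f1 t))"
    and f2: "is_pdf f2" "three_segment_form N2 n2 q2 f2"
    and X2: "distributed M lborel X2 (\<lambda>t. ennreal (f2 t))"
    and X: "X = (\<lambda>\<omega>. max (X1 \<omega>) (X2 \<omega>)) \<or> X = (\<lambda>\<omega>. X1 \<omega> + X2 \<omega>)"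
  shows "random_variable borel X" "integrable M (\<lambda>\<omega>. (X \<omega> - c)\<^sup>2)"
    "prob {\<omega> \<in> space M. X \<omega> = x} = 0"
proof -
  have rv1 [measurable]: "X1 \<in> borel_measurable M" and rv2 [measurable]: "X2 \<in> borel_measurable M"
    using distributed_measurable[OF X1] distributed_measurable[OF X2] by simp_all
  show rv [measurable]: "random_variable borel X"
    using X by (elim disjE) simp_all
  have i1: "integrable M (\<lambda>\<omega>. (X1 \<omega>)\<^sup>2)"
    using distributed_integrable[OF X1, of "\<lambda>t. t\<^sup>2"] three_segment_integrable_power[OF f1] f1(1)
    by (simp add: is_pdf_def)
  have i2: "integrable M (\<lambda>\<omega>. (X2 \<omega>)\<^sup>2)"
    using distributed_integrable[OF X2, of "\<lambda>t. t\<^sup>2"] three_segment_integrable_power[OF f2] f2(1)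
    by (simp add: is_pdf_def)
  show "integrable M (\<lambda>\<omega>. (X \<omega> - c)\<^sup>2)"
  proof (rule Bochner_Integration.integrable_bound)
    show "integrable M (\<lambda>\<omega>. 4 * (X1 \<omega>)\<^sup>2 + 4 * (X2 \<omega>)\<^sup>2 + 2 * c\<^sup>2)"
      using i1 i2 by auto
    have "(X \<omega> - c)\<^sup>2 \<le> 4 * (X1 \<omega>)\<^sup>2 + 4 * (X2 \<omega>)\<^sup>2 + 2 * c\<^sup>2" for \<omega>
    proof -
      have "(X \<omega> - c)\<^sup>2 \<le> 2 * (X \<omega>)\<^sup>2 + 2 * c\<^sup>2"
        using zero_le_power2[of "X \<omega> + c"] by (simp add: power2_eq_square algebra_simps)
      moreover have "(X \<omega>)\<^sup>2 \<le> 2 * (X1 \<omega>)\<^sup>2 + 2 * (X2 \<omega>)\<^sup>2"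
        using X
      proof
        assume "X = (\<lambda>\<omega>. max (X1 \<omega>) (X2 \<omega>))"
        then show ?thesis
          using zero_le_power2[of "X1 \<omega>"] zero_le_power2[of "X2 \<omega>"] by (auto simp: max_def)
      next
        assume "X = (\<lambda>\<omega>. X1 \<omega> + X2 \<omega>)"
        then show ?thesis
          using zero_le_power2[of "X1 \<omega> - X2 \<omega>"] by (simp add: power2_eq_square algebra_simps)
      qed
      ultimately show ?thesis by linarith
    qed
    then show "AE \<omega> in M. norm ((X \<omega> - c)\<^sup>2) \<le> norm (4 * (X1 \<omega>)\<^sup>2 + 4 * (X2 \<omega>)\<^sup>2 + 2 * c\<^sup>2)"
      by (auto intro: order_trans)
  qed measurable
  show "prob {\<omega> \<in> space M. X \<omega> = x} = 0"
    using X
  proof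
    assume "X = (\<lambda>\<omega>. max (X1 \<omega>) (X2 \<omega>))"
    then have "prob {\<omega> \<in> space M. X \<omega> = x}
        \<le> prob ({\<omega> \<in> space M. X1 \<omega> = x} \<union> {\<omega> \<in> space M. X2 \<omega> = x})"
      by (intro finite_measure_mono) (auto simp: max_def split: if_splits)
    also have "\<dots> \<le> prob {\<omega> \<in> space M. X1 \<omega> = x} + prob {\<omega> \<in> space M. X2 \<omega> = x}"
      by (intro measure_Un_le) auto
    finally show ?thesis
      using prob_distributed_lborel_singleton[OF X1] prob_distributed_lborel_singleton[OF X2]
        measure_nonneg[of M "{\<omega> \<in> space M. X \<omega> = x}"] by simp
  next
    assume "X = (\<lambda>\<omega>. X1 \<omega> + X2 \<omega>)"
    then show ?thesis
      using prob_distributed_lborel_singleton[OF distributed_convolution[OF ind X1 X2]] by simp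
  qed
qed

section \<open>Approximation by the three-segment form\<close>

lemma gauss_poly_coeff:
  assumes "degree p \<le> N"
  shows "gauss_poly N (coeff p) \<mu> \<sigma> t = poly p t * normal_density \<mu> \<sigma> t"
proof -
  have "poly p t = (\<Sum>j\<le>N. coeff p j * t ^ j)"
    unfolding poly_altdef using assms by (intro sum.mono_neutral_left) (auto simp: coeff_eq_0)
  then show ?thesis by (simp add: gauss_poly_def sum_distrib_right)
qed

lemma nn_integral_tail_left:
  assumes "\<And>y. 0 \<le> y \<Longrightarrow>
      (\<integral>\<^sup>+s. ennreal (poly p s * normal_density 0 \<sigma> s) * indicator {y..} s \<partial>lborel) = ennreal (B y)"
    and "x \<le> a"
  shows "(\<integral>\<^sup>+t. ennreal (poly p (a - t) * normal_density 0 \<sigma> (a - t)) * indicator {..x} t \<partial>lborel) = ennreal (B (a - x))"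
proof -
  have [measurable]: "poly p \<in> borel_measurable borel"
    by (intro borel_measurable_continuous_onI continuous_intros)
  have "ennreal (B (a - x))
      = (\<integral>\<^sup>+s. ennreal (poly p s * normal_density 0 \<sigma> s) * indicator {a - x..} s \<partial>lborel)"
    using assms by simp
  also have "\<dots> = (\<integral>\<^sup>+t. ennreal (poly p (a - t) * normal_density 0 \<sigma> (a - t)) * indicator {a - x..} (a - t) \<partial>lborel)"
    by (subst nn_integral_real_affine[where c = "-1" and t = a]) simp_all
  also have "\<dots> = (\<integral>\<^sup>+t. ennreal (poly p (a - t) * normal_density 0 \<sigma> (a - t)) * indicator {..x} t \<partial>lborel)"
    by (intro nn_integral_cong) (simp split: split_indicator)
  finally show ?thesis by simp
qed

lemma nn_integral_tail_right:
  assumes "\<And>y. 0 \<le> y \<Longrightarrow>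
      (\<integral>\<^sup>+s. ennreal (poly p s * normal_density 0 \<sigma> s) * indicator {y..} s \<partial>lborel) = ennreal (B y)"
    and "b \<le> x"
  shows "(\<integral>\<^sup>+t. ennreal (poly p (t - b) * normal_density 0 \<sigma> (t - b)) * indicator {x..} t \<partial>lborel) = ennreal (B (x - b))"
proof -
  have [measurable]: "poly p \<in> borel_measurable borel"
    by (intro borel_measurable_continuous_onI continuous_intros)
  have "ennreal (B (x - b))
      = (\<integral>\<^sup>+s. ennreal (poly p s * normal_density 0 \<sigma> s) * indicator {x - b..} s \<partial>lborel)"
    using assms by simp
  also have "\<dots> = (\<integral>\<^sup>+t. ennreal (poly p (t - b) * normal_density 0 \<sigma> (t - b)) * indicator {x - b..} (t - b) \<partial>lborel)"
    by (subst nn_integral_real_affine[where c = "1" and t = "- b"]) simp_all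
  also have "\<dots> = (\<integral>\<^sup>+t. ennreal (poly p (t - b) * normal_density 0 \<sigma> (t - b)) * indicator {x..} t \<partial>lborel)"
    by (intro nn_integral_cong) (simp split: split_indicator)
  finally show ?thesis by simp
qed

text \<open>Passing to a measure makes additivity and monotonicity available for the CDF of an
  approximant.\<close>

lemma set_integral_eq_measure_density:
  fixes f :: "real \<Rightarrow> real"
  assumes [measurable]: "f \<in> borel_measurable borel" "A \<in> sets borel" and "\<And>t. 0 \<le> f t"
  shows "(LBINT t:A. f t) = measure (density lborel (\<lambda>t. ennreal (f t))) A"
proof -
  have "(LBINT t:A. f t) = enn2real (\<integral>\<^sup>+t. ennreal (indicator A t *\<^sub>R f t) \<partial>lborel)"
    unfolding set_lebesgue_integral_def using assms by (intro integral_eq_nn_integral) auto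
  also have "(\<integral>\<^sup>+t. ennreal (indicator A t *\<^sub>R f t) \<partial>lborel) = (\<integral>\<^sup>+t. ennreal (f t) * indicator A t \<partial>lborel)"
    by (intro nn_integral_cong) (simp split: split_indicator)
  finally show ?thesis
    by (simp add: measure_def emeasure_density)
qed

text \<open>The density is glued from a reflected left tail, a step function of mean densities and a
  shifted right tail. Adding the masses of the subintervals one by one reproduces \<open>F\<close>
  at the partition points, and the total is \<open>F b + (1 - F b) = 1\<close>.\<close>

lemma three_segment_pdf_exists:
  fixes F :: "real \<Rightarrow> real"
  assumes ab: "a < b" and n: "1 \<le> n" and F: "mono F"
    and tails: "gauss_tail N pl \<sigma>l Bl" "gauss_tail N pr \<sigma>r Br"
    and mass: "Bl 0 = F a" "Br 0 = 1 - F b"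
    and q: "\<And>i. q i = a + real i * ((b - a) / real n)"
  shows "\<exists>f. is_pdf f \<and> three_segment_form N n q f \<and>
    (\<forall>x\<le>a. (LBINT t:{..x}. f t) = Bl (a - x)) \<and>
    (\<forall>x\<ge>b. (LBINT t:{..x}. f t) = 1 - Br (x - b)) \<and>
    (\<forall>i\<le>n. (LBINT t:{..q i}. f t) = F (q i)) \<and>
    mono (\<lambda>x. LBINT t:{..x}. f t)"
proof -
  have pl: "degree pl \<le> N" "0 < \<sigma>l" "\<And>y. 0 \<le> y \<Longrightarrow> 0 \<le> poly pl y"
      "\<And>y. 0 \<le> y \<Longrightarrow>
        (\<integral>\<^sup>+s. ennreal (poly pl s * normal_density 0 \<sigma>l s) * indicator {y..} s \<partial>lborel) = ennreal (Bl y)"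
      "\<And>y. 0 \<le> y \<Longrightarrow> 0 \<le> Bl y"
    using tails(1) by (simp_all add: gauss_tail_def)
  have pr: "degree pr \<le> N" "0 < \<sigma>r" "\<And>y. 0 \<le> y \<Longrightarrow> 0 \<le> poly pr y"
      "\<And>y. 0 \<le> y \<Longrightarrow>
        (\<integral>\<^sup>+s. ennreal (poly pr s * normal_density 0 \<sigma>r s) * indicator {y..} s \<partial>lborel) = ennreal (Br y)"
      "\<And>y. 0 \<le> y \<Longrightarrow> 0 \<le> Br y"
    using tails(2) by (simp_all add: gauss_tail_def)
  have q0: "q 0 = a" and qn: "q n = b" using n by (simp_all add: q)
  have qS: "q (Suc i) - q i = (b - a) / real n" for i
    by (simp add: q distrib_right add_divide_distrib)
  have q_less: "q i < q (Suc i)" for i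
    using qS[of i] ab n by (smt (verit) divide_pos_pos of_nat_0_less_iff less_le_trans zero_less_one)
  have q_mono: "q i \<le> q j" if "i \<le> j" for i j
    using that ab n by (simp add: q divide_right_mono mult_right_mono)
  \<comment> \<open>The increment of \<open>F\<close> divided by the width of the subinterval.
    Indices start at 0 here but at 1 in \<open>three_segment_form\<close>, hence
    \<open>P (i - 1)\<close> further down.\<close>
  define P where "P i = (F (q (Suc i)) - F (q i)) * (real n / (b - a))" for i
  have P: "0 \<le> P i" for i
    unfolding P_def using monoD[OF F less_imp_le[OF q_less]] ab by simp
  \<comment> \<open>In the middle, the floor of the rescaled distance from \<open>a\<close> is the
    index of the subinterval. The order of the cases gives \<open>a\<close> to the left tail and
    \<open>b\<close> to the right one.\<close>
  define f where "f t = (if t \<le> a then poly pl (a - t) * normal_density 0 \<sigma>l (a - t)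
      else if b \<le> t then poly pr (t - b) * normal_density 0 \<sigma>r (t - b)
      else P (nat \<lfloor>(t - a) * (real n / (b - a))\<rfloor>))" for t
  have f_mid: "f t = P i" if "q i \<le> t" "t < q (Suc i)" "a < t" "i < n" for t i
  proof -
    have "q (Suc i) \<le> b" using q_mono[of "Suc i" n] that(4) qn by simp
    then have "t < b" using that by simp
    have "(q i - a) * (real n / (b - a)) = real i" "(q (Suc i) - a) * (real n / (b - a)) = real i + 1"
      using ab n by (simp_all add: q)
    moreover have "(q i - a) * (real n / (b - a)) \<le> (t - a) * (real n / (b - a))"
      "(t - a) * (real n / (b - a)) < (q (Suc i) - a) * (real n / (b - a))"
      using that ab n by (intro mult_right_mono mult_strict_right_mono; simp)+
    ultimately have "\<lfloor>(t - a) * (real n / (b - a))\<rfloor> = int i"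
      by (intro floor_unique) simp_all
    with \<open>t < b\<close> that(3) show ?thesis by (simp add: f_def)
  qed
  have [measurable]: "poly p \<in> borel_measurable borel" for p :: "real poly"
    by (intro borel_measurable_continuous_onI continuous_intros)
  have f_meas [measurable]: "f \<in> borel_measurable borel"
    unfolding f_def[abs_def] by measurable
  have f_nonneg: "0 \<le> f t" for t
    using pl(3)[of "a - t"] pr(3)[of "t - b"] P by (simp add: f_def)
  define D where "D = density lborel (\<lambda>t. ennreal (f t))"
  have D: "emeasure D A = (\<integral>\<^sup>+t. ennreal (f t) * indicator A t \<partial>lborel)" if "A \<in> sets borel" for A
    unfolding D_def using that by (intro emeasure_density) auto
  have sets_D [measurable_cong, simp]: "sets D = sets borel" by (simp add: D_def)
  have left: "emeasure D {..x} = ennreal (Bl (a - x))" if "x \<le> a" for x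
  proof -
    have "emeasure D {..x}
        = (\<integral>\<^sup>+t. ennreal (poly pl (a - t) * normal_density 0 \<sigma>l (a - t)) * indicator {..x} t \<partial>lborel)"
      using that by (subst D) (auto intro!: nn_integral_cong simp: f_def split: split_indicator)
    also have "\<dots> = ennreal (Bl (a - x))"
      using that pl(4) by (intro nn_integral_tail_left)
    finally show ?thesis .
  qed
  \<comment> \<open>Open and closed half-lines differ by the null set of their endpoint.\<close>
  have right: "emeasure D {x<..} = ennreal (Br (x - b))" if "b \<le> x" for x
  proof -
    have "emeasure D {x<..}
        = (\<integral>\<^sup>+t. ennreal (poly pr (t - b) * normal_density 0 \<sigma>r (t - b)) * indicator {x..} t \<partial>lborel)"
      using that ab AE_lborel_singleton[of x]
      by (subst D) (auto intro!: nn_integral_cong_AE elim!: eventually_mono simp: f_def split: split_indicator)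
    also have "\<dots> = ennreal (Br (x - b))"
      using that pr(4) by (intro nn_integral_tail_right)
    finally show ?thesis .
  qed
  \<comment> \<open>Intervals open on the left fit together with \<open>{..q i}\<close>. At the
    right endpoint \<open>f\<close> may differ from \<open>P i\<close>, but only on a null
    set.\<close>
  have mid: "emeasure D {q i<..q (Suc i)} = ennreal (F (q (Suc i)) - F (q i))" if "i < n" for i
  proof -
    have "a \<le> q i" using q_mono[of 0 i] by (simp add: q0)
    then have "f t = P i" if "q i < t" "t \<le> q (Suc i)" "t \<noteq> q (Suc i)" for t
      using f_mid[of i t] that \<open>i < n\<close> by simp
    then have "emeasure D {q i<..q (Suc i)} = (\<integral>\<^sup>+t. ennreal (P i) * indicator {q i<..q (Suc i)} t \<partial>lborel)"
      using AE_lborel_singleton[of "q (Suc i)"]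
      by (subst D) (auto intro!: nn_integral_cong_AE elim!: eventually_mono split: split_indicator)
    also have "\<dots> = ennreal (P i) * ennreal ((b - a) / real n)"
      using q_less[of i] by (simp add: nn_integral_cmult_indicator qS)
    also have "\<dots> = ennreal (F (q (Suc i)) - F (q i))"
      using ab n P by (simp add: P_def flip: ennreal_mult)
    finally show ?thesis .
  qed
  \<comment> \<open>The left tail has mass \<open>F a\<close>, so \<open>F a\<close> is
    non-negative, and monotonicity carries this to all partition points.\<close>
  have F_nonneg: "0 \<le> F (q i)" for i
    using pl(5)[of 0] mass(1) monoD[OF F q_mono[of 0 i]] by (simp add: q0)
  have grid: "emeasure D {..q i} = ennreal (F (q i))" if "i \<le> n" for i
    using that
  proof (induction i)
    case 0
    then show ?case using left[of a] mass(1) by (simp add: q0)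
  next
    case (Suc i)
    have "{..q (Suc i)} = {..q i} \<union> {q i<..q (Suc i)}"
      using q_less[of i] by auto
    then have "emeasure D {..q (Suc i)} = emeasure D {..q i} + emeasure D {q i<..q (Suc i)}"
      by (simp only:) (subst plus_emeasure, auto)
    also have "\<dots> = ennreal (F (q i)) + ennreal (F (q (Suc i)) - F (q i))"
      using Suc mid[of i] by simp
    also have "\<dots> = ennreal (F (q (Suc i)))"
      using F_nonneg monoD[OF F less_imp_le[OF q_less[of i]]] by (simp flip: ennreal_plus)
    finally show ?case .
  qed
  have "emeasure D UNIV = emeasure D {..b} + emeasure D {b<..}"
  proof -
    have "emeasure D ({..b} \<union> {b<..}) = emeasure D {..b} + emeasure D {b<..}"
      by (subst plus_emeasure) auto
    moreover have "{..b} \<union> {b<..} = UNIV" by auto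
    ultimately show ?thesis by simp
  qed
  also have "\<dots> = ennreal (F b) + ennreal (1 - F b)"
    using grid[of n] right[of b] mass(2) by (simp add: qn)
  also have "\<dots> = 1"
    using F_nonneg[of n] pr(5)[of 0] mass(2) by (simp add: qn flip: ennreal_plus)
  finally have total: "emeasure D UNIV = 1" .
  interpret D: prob_space D
    by standard (simp add: D_def total[unfolded D_def])
  have space_D: "space D = UNIV" by (simp add: D_def)
  have pdf: "is_pdf f"
    unfolding is_pdf_def using f_meas f_nonneg D[of UNIV] total by simp
  have LB: "(LBINT t:{..x}. f t) = measure D {..x}" for x
    unfolding D_def using f_nonneg by (intro set_integral_eq_measure_density) auto
  have form: "three_segment_form N n q f"
    unfolding three_segment_form_def
  proof (intro conjI ballI)
    show "1 \<le> n" by (rule n)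
    fix i assume i: "i \<in> {1..n}"
    then have i1: "Suc (i - 1) = i" "i - 1 < n" by auto
    show "q (i - 1) < q i" "q i - q (i - 1) = (q n - q 0) / real n"
      using q_less[of "i - 1"] qS[of "i - 1"] i1 by (simp_all add: q0 qn)
  next
    \<comment> \<open>Composing with a linear polynomial moves the origin to the endpoint without
      raising the degree. The Gaussian is symmetric, so the reflected left tail simply has mean
      \<open>a\<close>.\<close>
    let ?pl = "pcompose pl [:a, -1:]" and ?pr = "pcompose pr [:- b, 1:]"
    have dl: "degree ?pl \<le> N" and dr: "degree ?pr \<le> N"
      using degree_pcompose_le[of pl "[:a, -1:]"] degree_pcompose_le[of pr "[:- b, 1:]"] pl(1) pr(1) by simp_all
    have "\<forall>t. t \<le> q 0 \<longrightarrow> f t = gauss_poly N (coeff ?pl) a \<sigma>l t"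
      by (auto simp: q0 f_def gauss_poly_coeff[OF dl] poly_pcompose normal_density_def power2_commute)
    moreover have "\<forall>t. q n \<le> t \<longrightarrow> f t = gauss_poly N (coeff ?pr) b \<sigma>r t"
      using ab by (auto simp: qn f_def gauss_poly_coeff[OF dr] poly_pcompose normal_density_def)
    moreover have "\<forall>i\<in>{1..n}. \<forall>t. q 0 < t \<and> q (i - 1) \<le> t \<and> t < q i \<longrightarrow> f t = P (i - 1)"
    proof (intro ballI allI impI)
      fix i t assume "i \<in> {1..n}" "q 0 < t \<and> q (i - 1) \<le> t \<and> t < q i"
      then have "q (i - 1) \<le> t" "t < q (Suc (i - 1))" "a < t" "i - 1 < n"
        by (auto simp: q0)
      then show "f t = P (i - 1)" by (rule f_mid)
    qed
    ultimately show "\<exists>cl \<mu>l \<sigma>l cr \<mu>r \<sigma>r P. 0 < \<sigma>l \<and> 0 < \<sigma>r \<and>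
        (\<forall>t. t \<le> q 0 \<longrightarrow> f t = gauss_poly N cl \<mu>l \<sigma>l t) \<and>
        (\<forall>i\<in>{1..n}. \<forall>t. q 0 < t \<and> q (i - 1) \<le> t \<and> t < q i \<longrightarrow> f t = P i) \<and>
        (\<forall>t. q n \<le> t \<longrightarrow> f t = gauss_poly N cr \<mu>r \<sigma>r t)"
      using pl(2) pr(2)
      by (intro exI[of _ "coeff ?pl"] exI[of _ a] exI[of _ \<sigma>l] exI[of _ "coeff ?pr"] exI[of _ b]
          exI[of _ \<sigma>r] exI[of _ "\<lambda>i. P (i - 1)"] conjI)
  qed
  have "measure D {..x} = Bl (a - x)" if "x \<le> a" for x
    using left[OF that] pl(5)[of "a - x"] that by (simp add: measure_def)
  moreover have "measure D {..x} = 1 - Br (x - b)" if "b \<le> x" for x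
  proof -
    have "measure D {x<..} = Br (x - b)"
      using right[OF that] pr(5)[of "x - b"] that by (simp add: measure_def)
    moreover have "space D - {x<..} = {..x}" by (auto simp: space_D)
    ultimately show ?thesis using D.prob_compl[of "{x<..}"] by simp
  qed
  moreover have "measure D {..q i} = F (q i)" if "i \<le> n" for i
    using grid[OF that] F_nonneg by (simp add: measure_def)
  moreover have "mono (\<lambda>x. measure D {..x})"
    by (intro monoI D.finite_measure_mono) auto
  ultimately show ?thesis
    using pdf form by (intro exI[of _ f] conjI allI impI) (simp_all add: LB)
qed

text \<open>Once the integral is below 1 it is finite, so the infinite branch of
  \<open>L2_norm\<close> is eventually avoided and the square root is continuous at 0.\<close>

lemma L2_norm_tendsto_0:
  assumes "((\<lambda>z. \<integral>\<^sup>+x. ennreal ((g z x)\<^sup>2) \<partial>lborel) \<longlongrightarrow> 0) Z"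
  shows "((\<lambda>z. L2_norm (g z)) \<longlongrightarrow> 0) Z"
proof -
  let ?I = "\<lambda>z. \<integral>\<^sup>+x. ennreal ((g z x)\<^sup>2) \<partial>lborel"
  have "((\<lambda>z. sqrt (enn2real (?I z))) \<longlongrightarrow> sqrt 0) Z"
    using assms by (intro tendsto_real_sqrt tendsto_enn2real) simp_all
  then have *: "((\<lambda>z. ennreal (sqrt (enn2real (?I z)))) \<longlongrightarrow> 0) Z"
    using tendsto_ennrealI by fastforce
  have "eventually (\<lambda>z. ?I z < 1) Z"
    using assms by (intro order_tendstoD) auto
  then have "eventually (\<lambda>z. ennreal (sqrt (enn2real (?I z))) = L2_norm (g z)) Z"
    by eventually_elim (auto simp: L2_norm_def Let_def)
  then show ?thesis
    using * by (simp cong: tendsto_cong)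
qed

text \<open>Outside the interval from \<open>a\<close> to \<open>b\<close> the error depends on
  \<open>N\<close> alone; inside it is bounded by a quantity depending on \<open>n\<close> alone.
  This is why the joint limit holds without any coupling of \<open>N\<close> and
  \<open>n\<close>.\<close>

lemma three_segment_approximation:
  fixes F :: "real \<Rightarrow> real"
  assumes ab: "a < b" and F: "mono F" "continuous_on UNIV F" "\<And>x. 0 \<le> F x" "\<And>x. F x \<le> 1"
    and decay_left: "\<And>y. 0 \<le> y \<Longrightarrow> F (a - y) \<le> C / (1 + y\<^sup>2)"
    and decay_right: "\<And>y. 0 \<le> y \<Longrightarrow> 1 - F (b + y) \<le> C' / (1 + y\<^sup>2)"
  shows "\<exists>f :: nat \<Rightarrow> nat \<Rightarrow> real \<Rightarrow> real.
    (\<forall>N n. 1 \<le> n \<longrightarrow>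
       is_pdf (f N n) \<and>
       (\<exists>q. q 0 = a \<and> q n = b \<and> three_segment_form N n q (f N n))) \<and>
    ((\<lambda>(N, n). L2_norm (\<lambda>x. F x - (LBINT t:{..x}. f N n t))) \<longlongrightarrow> 0)
      (at_top \<times>\<^sub>F at_top) \<and>
    (\<forall>x. ((\<lambda>(N, n). F x - (LBINT t:{..x}. f N n t)) \<longlongrightarrow> 0) (at_top \<times>\<^sub>F at_top))"
proof -

  \<comment> \<open>Choice of the tails and of the densities\<close>
  let ?Gl = "\<lambda>y. F (a - y)" and ?Gr = "\<lambda>y. 1 - F (b + y)"
  have Gl: "\<And>x y. 0 \<le> x \<Longrightarrow> x \<le> y \<Longrightarrow> ?Gl y \<le> ?Gl x" "\<And>y. 0 \<le> ?Gl y" "\<And>y. ?Gl y \<le> 1"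
    "continuous_on UNIV ?Gl"
    using F by (auto intro!: monoD[OF F(1)] continuous_on_compose2[OF F(2)] continuous_intros)
  have Gr: "\<And>x y. 0 \<le> x \<Longrightarrow> x \<le> y \<Longrightarrow> ?Gr y \<le> ?Gr x" "\<And>y. 0 \<le> ?Gr y" "\<And>y. ?Gr y \<le> 1"
    "continuous_on UNIV ?Gr"
    using F by (auto intro!: monoD[OF F(1)] continuous_on_compose2[OF F(2)] continuous_intros)
  obtain pl \<sigma>l Bl where l: "\<And>N. gauss_tail N (pl N) (\<sigma>l N) (Bl N)" "\<And>N. Bl N 0 = ?Gl 0"
    "\<And>y. 0 \<le> y \<Longrightarrow> (\<lambda>N. Bl N y) \<longlonglongrightarrow> ?Gl y"
    "(\<lambda>N. \<integral>\<^sup>+y. ennreal ((Bl N y - ?Gl y)\<^sup>2) * indicator {0..} y \<partial>lborel) \<longlonglongrightarrow> 0"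
    using tail_approximation[of ?Gl C, OF Gl decay_left] by blast
  obtain pr \<sigma>r Br where r: "\<And>N. gauss_tail N (pr N) (\<sigma>r N) (Br N)" "\<And>N. Br N 0 = ?Gr 0"
    "\<And>y. 0 \<le> y \<Longrightarrow> (\<lambda>N. Br N y) \<longlonglongrightarrow> ?Gr y"
    "(\<lambda>N. \<integral>\<^sup>+y. ennreal ((Br N y - ?Gr y)\<^sup>2) * indicator {0..} y \<partial>lborel) \<longlonglongrightarrow> 0"
    using tail_approximation[of ?Gr C', OF Gr decay_right] by blast
  have [measurable]: "Bl N \<in> borel_measurable borel" "Br N \<in> borel_measurable borel" for N
    using l(1)[of N] r(1)[of N] by (simp_all add: gauss_tail_def)
  define q where "q n i = a + real i * ((b - a) / real n)" for n i :: nat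
  define Q where "Q N n f \<longleftrightarrow> is_pdf f \<and> three_segment_form N n (q n) f \<and>
      (\<forall>x\<le>a. (LBINT t:{..x}. f t) = Bl N (a - x)) \<and>
      (\<forall>x\<ge>b. (LBINT t:{..x}. f t) = 1 - Br N (x - b)) \<and>
      (\<forall>i\<le>n. (LBINT t:{..q n i}. f t) = F (q n i)) \<and>
      mono (\<lambda>x. LBINT t:{..x}. f t)" for N n f
  have ex: "\<exists>f. Q N n f" if "1 \<le> n" for N n
  proof -
    have "Bl N 0 = F a" "Br N 0 = 1 - F b" using l(2) r(2) by simp_all
    from three_segment_pdf_exists[OF ab that F(1) l(1) r(1) this, of "q n"]
    show ?thesis by (simp add: Q_def q_def)
  qed
  \<comment> \<open>For \<open>n = 0\<close> nothing satisfies \<open>Q\<close> and the choice is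
    arbitrary; the properties below are claimed for \<open>n \<ge> 1\<close> only.\<close>
  define f where "f N n = (SOME f. Q N n f)" for N n
  have "Q N n (f N n)" if "1 \<le> n" for N n
    unfolding f_def using ex[OF that] by (rule someI_ex)
  then have f: "\<And>N n. 1 \<le> n \<Longrightarrow> is_pdf (f N n)"
    "\<And>N n. 1 \<le> n \<Longrightarrow> three_segment_form N n (q n) (f N n)"
    and f_left: "\<And>N n x. 1 \<le> n \<Longrightarrow> x \<le> a \<Longrightarrow> (LBINT t:{..x}. f N n t) = Bl N (a - x)"
    and f_right: "\<And>N n x. 1 \<le> n \<Longrightarrow> b \<le> x \<Longrightarrow> (LBINT t:{..x}. f N n t) = 1 - Br N (x - b)"
    and f_grid: "\<And>N n i. 1 \<le> n \<Longrightarrow> i \<le> n \<Longrightarrow> (LBINT t:{..q n i}. f N n t) = F (q n i)"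
    and f_mono: "\<And>N n. 1 \<le> n \<Longrightarrow> mono (\<lambda>x. LBINT t:{..x}. f N n t)"
    unfolding Q_def by simp_all
  define e where "e N n x = F x - (LBINT t:{..x}. f N n t)" for N n x

  \<comment> \<open>Increments of \<open>F\<close> over the partition and the error on each
    segment\<close>
  define \<omega> where "\<omega> n = Max ((\<lambda>i. F (q n (Suc i)) - F (q n i)) ` {..<n})" for n
  have q_ends: "q n 0 = a" "q n n = b" if "1 \<le> n" for n
    using that by (simp_all add: q_def)
  have q_mono: "q n i \<le> q n j" if "i \<le> j" for n i j
    using that ab by (simp add: q_def divide_right_mono mult_right_mono)
  have \<omega>_ge: "F (q n (Suc i)) - F (q n i) \<le> \<omega> n" if "i < n" for n i
    unfolding \<omega>_def using that by (intro Max_ge) auto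
  have \<omega>_nonneg: "0 \<le> \<omega> n" if "1 \<le> n" for n
    using \<omega>_ge[of 0 n] that monoD[OF F(1) q_mono[of 0 "Suc 0" n]] by simp
  have \<omega>_lim: "\<omega> \<longlonglongrightarrow> 0"
  proof (rule tendstoI)
    fix \<eta> :: real assume \<eta>: "0 < \<eta>"
    \<comment> \<open>Uniform continuity bounds all increments at once as soon as the common width
      is below \<open>d\<close>.\<close>
    have "uniformly_continuous_on {a..b} F"
      using F(2) by (intro compact_uniformly_continuous) (auto intro: continuous_on_subset)
    then obtain d where d: "0 < d" "\<And>x y. x \<in> {a..b} \<Longrightarrow> y \<in> {a..b} \<Longrightarrow> dist y x < d \<Longrightarrow> dist (F y) (F x) < \<eta>"
      unfolding uniformly_continuous_on_def using \<eta> by metis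
    have "(\<lambda>n. (b - a) / real n) \<longlonglongrightarrow> 0" by real_asymp
    then have "eventually (\<lambda>n. (b - a) / real n < d) sequentially"
      using d by (intro order_tendstoD) auto
    then show "eventually (\<lambda>n. dist (\<omega> n) 0 < \<eta>) sequentially"
      using eventually_ge_at_top[of 1]
    proof eventually_elim
      case (elim n)
      have "F (q n (Suc i)) - F (q n i) < \<eta>" if "i < n" for i
      proof -
        have "q n i \<in> {a..b}" "q n (Suc i) \<in> {a..b}"
          using q_ends[OF elim(2)] q_mono[of 0 i n] q_mono[of i n n] q_mono[of 0 "Suc i" n] q_mono[of "Suc i" n n] that
          by auto
        moreover have "dist (q n (Suc i)) (q n i) < d"
          using elim ab by (simp add: q_def dist_real_def distrib_right add_divide_distrib)
        ultimately show ?thesis using d(2)[of "q n i" "q n (Suc i)"] by (simp add: dist_real_def)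
      qed
      then have "\<omega> n < \<eta>"
        unfolding \<omega>_def using elim(2) by (subst Max_less_iff) (auto simp: lessThan_empty_iff)
      with \<omega>_nonneg[OF elim(2)] show ?case by simp
    qed
  qed
  have e_left: "e N n x = ?Gl (a - x) - Bl N (a - x)" if "1 \<le> n" "x \<le> a" for N n x
    using that by (simp add: e_def f_left)
  have e_right: "e N n x = Br N (x - b) - ?Gr (x - b)" if "1 \<le> n" "b \<le> x" for N n x
    using that by (simp add: e_def f_right)
  have e_mid: "\<bar>e N n x\<bar> \<le> \<omega> n" if n: "1 \<le> n" and x: "a \<le> x" "x \<le> b" for N n x
  proof (cases "x = b")
    case True
    then show ?thesis using f_grid[OF n, of n] q_ends[OF n] \<omega>_nonneg[OF n] by (simp add: e_def)
  next
    case False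
    \<comment> \<open>The least such index locates the subinterval containing \<open>x\<close>. The
      point \<open>b\<close> was set apart because subintervals are half-open on the right.\<close>
    define i where "i = (LEAST i. x < q n (Suc i))"
    have "x < q n (Suc (n - 1))" using False x n q_ends by simp
    then have i: "x < q n (Suc i)" "i \<le> n - 1"
      unfolding i_def by (rule LeastI, rule Least_le)
    have "q n i \<le> x"
    proof (cases i)
      case 0
      then show ?thesis using x q_ends n by simp
    next
      case (Suc j)
      then have "\<not> x < q n (Suc j)"
        unfolding i_def by (intro not_less_Least) simp
      with Suc show ?thesis by simp
    qed
    \<comment> \<open>Both CDFs are monotone and agree at the two partition points around
      \<open>x\<close>, so both values lie in one interval of length at most
      \<open>\<omega> n\<close>.\<close>
    have "F (q n i) \<le> F x" "F x \<le> F (q n (Suc i))"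
      using \<open>q n i \<le> x\<close> i by (auto intro: monoD[OF F(1)])
    moreover have "F (q n i) \<le> (LBINT t:{..x}. f N n t)" "(LBINT t:{..x}. f N n t) \<le> F (q n (Suc i))"
      using monoD[OF f_mono[OF n, of N] \<open>q n i \<le> x\<close>] monoD[OF f_mono[OF n, of N] less_imp_le[OF i(1)]]
        f_grid[OF n, of i N] f_grid[OF n, of "Suc i" N] i(2) n by simp_all
    moreover have "F (q n (Suc i)) - F (q n i) \<le> \<omega> n"
      using i n by (intro \<omega>_ge) auto
    ultimately show ?thesis unfolding e_def by linarith
  qed

  \<comment> \<open>Pointwise convergence\<close>
  have ev: "eventually (\<lambda>z. 1 \<le> snd z) (at_top \<times>\<^sub>F at_top :: (nat \<times> nat) filter)"
    by (rule eventually_compose_filterlim[OF eventually_ge_at_top filterlim_snd])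
  have pointwise: "((\<lambda>(N, n). e N n x) \<longlongrightarrow> 0) (at_top \<times>\<^sub>F at_top)" for x
  proof -
    \<comment> \<open>The bound is separated into a null sequence in \<open>N\<close> and one in
      \<open>n\<close>, each of which converges along its own projection of the product
      filter.\<close>
    obtain u where u: "u \<longlonglongrightarrow> 0" "\<And>N n. 1 \<le> n \<Longrightarrow> \<bar>e N n x\<bar> \<le> u N + \<omega> n"
    proof -
      consider "x \<le> a" | "b \<le> x" | "a \<le> x" "x \<le> b" by linarith
      then show thesis
      proof cases
        case 1
        have "(\<lambda>N. \<bar>?Gl (a - x) - Bl N (a - x)\<bar>) \<longlonglongrightarrow> \<bar>?Gl (a - x) - ?Gl (a - x)\<bar>"
          using 1 by (intro tendsto_intros l(3)) simp
        then show ?thesis using e_left[OF _ 1] \<omega>_nonneg by (intro that) auto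
      next
        case 2
        have "(\<lambda>N. \<bar>Br N (x - b) - ?Gr (x - b)\<bar>) \<longlonglongrightarrow> \<bar>?Gr (x - b) - ?Gr (x - b)\<bar>"
          using 2 by (intro tendsto_intros r(3)) simp
        then show ?thesis using e_right[OF _ 2] \<omega>_nonneg by (intro that) auto
      next
        case 3
        then show ?thesis using e_mid by (intro that[of "\<lambda>_. 0"]) auto
      qed
    qed
    have "((\<lambda>z. u (fst z) + \<omega> (snd z)) \<longlongrightarrow> 0 + 0) (at_top \<times>\<^sub>F at_top)"
      by (rule tendsto_add[OF filterlim_compose[OF u(1) filterlim_fst] filterlim_compose[OF \<omega>_lim filterlim_snd]])
    then have "((\<lambda>z. u (fst z) + \<omega> (snd z)) \<longlongrightarrow> 0) (at_top \<times>\<^sub>F at_top)"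
      by simp
    moreover have "eventually (\<lambda>z. norm (case z of (N, n) \<Rightarrow> e N n x) \<le> u (fst z) + \<omega> (snd z))
        (at_top \<times>\<^sub>F at_top)"
      using ev by (rule eventually_mono) (simp add: case_prod_unfold u(2))
    ultimately show ?thesis
      by (rule Lim_null_comparison[rotated])
  qed

  \<comment> \<open>Convergence in the L2 norm\<close>
  let ?L = "\<lambda>N. \<integral>\<^sup>+y. ennreal ((Bl N y - ?Gl y)\<^sup>2) * indicator {0..} y \<partial>lborel"
  let ?R = "\<lambda>N. \<integral>\<^sup>+y. ennreal ((Br N y - ?Gr y)\<^sup>2) * indicator {0..} y \<partial>lborel"
  have [measurable]: "F \<in> borel_measurable borel"
    using F(2) by (rule borel_measurable_continuous_onI)
  \<comment> \<open>The squared error is split by region: each tail contributes its one-sided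
    integral after a reflection or shift, and the middle at most the square of
    \<open>\<omega> n\<close> times the length \<open>b - a\<close>.\<close>
  have L2_bound: "(\<integral>\<^sup>+x. ennreal ((e N n x)\<^sup>2) \<partial>lborel)
      \<le> ?L N + ?R N + ennreal ((\<omega> n)\<^sup>2) * ennreal (b - a)" if n: "1 \<le> n" for N n
  proof -
    have "(\<integral>\<^sup>+x. ennreal ((e N n x)\<^sup>2) \<partial>lborel) \<le>
        (\<integral>\<^sup>+x. ennreal ((Bl N (a - x) - ?Gl (a - x))\<^sup>2) * indicator {0..} (a - x)
          + ennreal ((Br N (x - b) - ?Gr (x - b))\<^sup>2) * indicator {0..} (x - b)
          + ennreal ((\<omega> n)\<^sup>2) * indicator {a..b} x \<partial>lborel)"
    proof (intro nn_integral_mono)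
      fix x
      have le_sum: "A \<le> A + B + C" "B \<le> A + B + C" "C \<le> A + B + C" for A B C :: ennreal
        by (simp_all add: add_increasing add_increasing2)
      consider "x \<le> a" | "b \<le> x" | "a < x" "x < b" by linarith
      then show "ennreal ((e N n x)\<^sup>2)
          \<le> ennreal ((Bl N (a - x) - ?Gl (a - x))\<^sup>2) * indicator {0..} (a - x)
          + ennreal ((Br N (x - b) - ?Gr (x - b))\<^sup>2) * indicator {0..} (x - b)
          + ennreal ((\<omega> n)\<^sup>2) * indicator {a..b} x"
      proof cases
        case 1
        then have "ennreal ((e N n x)\<^sup>2) = ennreal ((Bl N (a - x) - ?Gl (a - x))\<^sup>2) * indicator {0..} (a - x)"
          using e_left[OF n] by (simp add: power2_commute)
        then show ?thesis by (simp only: le_sum)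
      next
        case 2
        then have "ennreal ((e N n x)\<^sup>2) = ennreal ((Br N (x - b) - ?Gr (x - b))\<^sup>2) * indicator {0..} (x - b)"
          using e_right[OF n] by simp
        then show ?thesis by (simp only: le_sum)
      next
        case 3
        then have "(e N n x)\<^sup>2 \<le> (\<omega> n)\<^sup>2"
          using e_mid[OF n, of x N] by (intro abs_le_square_iff[THEN iffD1]) linarith
        with 3 have "ennreal ((e N n x)\<^sup>2) \<le> ennreal ((\<omega> n)\<^sup>2) * indicator {a..b} x"
          by (simp add: ennreal_leI)
        then show ?thesis by (rule order_trans) (rule le_sum)
      qed
    qed
    also have "\<dots> = (\<integral>\<^sup>+x. ennreal ((Bl N (a - x) - ?Gl (a - x))\<^sup>2) * indicator {0..} (a - x) \<partial>lborel)
        + (\<integral>\<^sup>+x. ennreal ((Br N (x - b) - ?Gr (x - b))\<^sup>2) * indicator {0..} (x - b) \<partial>lborel)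
        + (\<integral>\<^sup>+x. ennreal ((\<omega> n)\<^sup>2) * indicator {a..b} x \<partial>lborel)"
    proof -
      have "(\<lambda>x. ennreal ((Bl N (a - x) - ?Gl (a - x))\<^sup>2) * indicator {0..} (a - x)) \<in> borel_measurable lborel"
        "(\<lambda>x. ennreal ((Br N (x - b) - ?Gr (x - b))\<^sup>2) * indicator {0..} (x - b)) \<in> borel_measurable lborel"
        "(\<lambda>x. ennreal ((\<omega> n)\<^sup>2) * indicator {a..b} x) \<in> borel_measurable lborel"
        by measurable
      then show ?thesis
        by (simp only: nn_integral_add borel_measurable_add)
    qed
    also have "(\<integral>\<^sup>+x. ennreal ((Bl N (a - x) - ?Gl (a - x))\<^sup>2) * indicator {0..} (a - x) \<partial>lborel) = ?L N"
      by (subst nn_integral_real_affine[where c = "-1" and t = a and f = "\<lambda>y. ennreal ((Bl N y - ?Gl y)\<^sup>2) * indicator {0..} y"])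
         simp_all
    also have "(\<integral>\<^sup>+x. ennreal ((Br N (x - b) - ?Gr (x - b))\<^sup>2) * indicator {0..} (x - b) \<partial>lborel) = ?R N"
      by (subst nn_integral_real_affine[where c = 1 and t = "- b" and f = "\<lambda>y. ennreal ((Br N y - ?Gr y)\<^sup>2) * indicator {0..} y"])
         simp_all
    also have "(\<integral>\<^sup>+x. ennreal ((\<omega> n)\<^sup>2) * indicator {a..b} x \<partial>lborel) = ennreal ((\<omega> n)\<^sup>2) * ennreal (b - a)"
      using ab by (simp add: nn_integral_cmult_indicator)
    finally show ?thesis .
  qed
  have "((\<lambda>z. \<integral>\<^sup>+x. ennreal ((e (fst z) (snd z) x)\<^sup>2) \<partial>lborel) \<longlongrightarrow> 0) (at_top \<times>\<^sub>F at_top)"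
  proof (rule tendsto_sandwich[of "\<lambda>_. 0"])
    have "(\<lambda>n. (\<omega> n)\<^sup>2 * (b - a)) \<longlonglongrightarrow> 0\<^sup>2 * (b - a)"
      by (intro tendsto_intros \<omega>_lim)
    from tendsto_ennrealI[OF this] have W: "(\<lambda>n. ennreal ((\<omega> n)\<^sup>2) * ennreal (b - a)) \<longlonglongrightarrow> 0"
      using ab by (simp add: ennreal_mult')
    note limits = filterlim_compose[OF l(4) filterlim_fst] filterlim_compose[OF r(4) filterlim_fst]
      filterlim_compose[OF W filterlim_snd]
    have "((\<lambda>z. ?L (fst z) + ?R (fst z) + ennreal ((\<omega> (snd z))\<^sup>2) * ennreal (b - a)) \<longlongrightarrow> 0 + 0 + 0)
        (at_top \<times>\<^sub>F at_top)"
      by (rule tendsto_add[OF tendsto_add[OF limits(1,2)] limits(3)])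
    then show "((\<lambda>z. ?L (fst z) + ?R (fst z) + ennreal ((\<omega> (snd z))\<^sup>2) * ennreal (b - a)) \<longlongrightarrow> 0)
        (at_top \<times>\<^sub>F at_top)"
      by simp
    show "eventually (\<lambda>z. (\<integral>\<^sup>+x. ennreal ((e (fst z) (snd z) x)\<^sup>2) \<partial>lborel)
        \<le> ?L (fst z) + ?R (fst z) + ennreal ((\<omega> (snd z))\<^sup>2) * ennreal (b - a)) (at_top \<times>\<^sub>F at_top)"
      using ev by eventually_elim (rule L2_bound)
  qed simp_all
  from L2_norm_tendsto_0[OF this]
  have "((\<lambda>(N, n). L2_norm (e N n)) \<longlongrightarrow> 0) (at_top \<times>\<^sub>F at_top)"
    by (simp add: case_prod_unfold)
  then have L2: "((\<lambda>(N, n). L2_norm (\<lambda>x. F x - (LBINT t:{..x}. f N n t))) \<longlongrightarrow> 0) (at_top \<times>\<^sub>F at_top)"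
    unfolding e_def .
  show ?thesis
  proof (intro exI[of _ f] conjI allI impI)
    fix N n :: nat assume n: "1 \<le> n"
    show "is_pdf (f N n)" using n by (rule f)
    show "\<exists>q. q 0 = a \<and> q n = b \<and> three_segment_form N n q (f N n)"
      using f(2)[OF n] q_ends[OF n] by blast
  qed (use L2 pointwise in \<open>simp_all add: e_def\<close>)
qed

theorem theorem4p3:
  fixes M :: "'a measure"
    and X1 X2 X :: "'a \<Rightarrow> real"
    and f1 f2 :: "real \<Rightarrow> real"
    and N1 N2 n1 n2 :: nat
    and q1 q2 :: "nat \<Rightarrow> real"
    and F :: "real \<Rightarrow> real"
    and \<epsilon> a b :: real
  assumes "prob_space M"
    and "prob_space.indep_var M borel X1 borel X2"
    and "is_pdf f1" and "three_segment_form N1 n1 q1 f1"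
    and "distributed M lborel X1 (\<lambda>t. ennreal (f1 t))"
    and "is_pdf f2" and "three_segment_form N2 n2 q2 f2"
    and "distributed M lborel X2 (\<lambda>t. ennreal (f2 t))"
    and "X = (\<lambda>\<omega>. max (X1 \<omega>) (X2 \<omega>)) \<or> X = (\<lambda>\<omega>. X1 \<omega> + X2 \<omega>)"
    and "F = cdf (distr M borel X)"
    and "0 < \<epsilon>" and "\<epsilon> < 1 / 2"
    and "F a = \<epsilon>" and "F b = 1 - \<epsilon>"
  shows "\<exists>f :: nat \<Rightarrow> nat \<Rightarrow> real \<Rightarrow> real.
    (\<forall>N n. 1 \<le> n \<longrightarrow>
       is_pdf (f N n) \<and>
       (\<exists>q. q 0 = a \<and> q n = b \<and> three_segment_form N n q (f N n))) \<and>
    ((\<lambda>(N, n). L2_norm (\<lambda>x. F x - (LBINT t:{..x}. f N n t))) \<longlongrightarrow> 0)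
      (at_top \<times>\<^sub>F at_top) \<and>
    (\<forall>x. ((\<lambda>(N, n). F x - (LBINT t:{..x}. f N n t)) \<longlongrightarrow> 0) (at_top \<times>\<^sub>F at_top))"
proof -
  interpret prob_space M by fact
  note props = max_or_sum_properties[OF assms(2-9)]
  note [measurable] = props(1)
  interpret D: real_distribution "distr M borel X"
    by (rule real_distribution_distr) (rule props(1))
  have F_prob: "F x = prob {\<omega> \<in> space M. X \<omega> \<le> x}" for x
    unfolding assms(10) cdf_def by (subst measure_distr) (auto intro!: arg_cong[where f = prob])
  have F_mono: "mono F"
    unfolding assms(10) by (intro monoI D.cdf_nondecreasing)
  have F_cont: "continuous_on UNIV F"
  proof (intro continuous_at_imp_continuous_on ballI)
    fix x
    have "measure (distr M borel X) {x} = prob {\<omega> \<in> space M. X \<omega> = x}"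
      by (subst measure_distr) (auto intro!: arg_cong[where f = prob])
    then show "isCont F x"
      unfolding assms(10) D.isCont_cdf by (simp add: props(3))
  qed
  show ?thesis
  \<comment> \<open>Both constants come from \<open>prob_le_second_moment\<close>, applied with the
    second moment of \<open>X\<close> about the respective endpoint.\<close>
  proof (rule three_segment_approximation[where C = "1 + expectation (\<lambda>\<omega>. (X \<omega> - a)\<^sup>2)"
        and C' = "1 + expectation (\<lambda>\<omega>. (X \<omega> - b)\<^sup>2)"])
    \<comment> \<open>The level \<epsilon> at \<open>a\<close> is strictly below the level 1 -
      \<epsilon> at \<open>b\<close>, because \<epsilon> < 1/2; monotonicity then orders the
      endpoints.\<close>
    show "a < b"
    proof (rule ccontr)
      assume "\<not> a < b"
      then have "F b \<le> F a" by (intro monoD[OF F_mono]) simp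
      then show False using assms(11-14) by simp
    qed
    show "F (a - y) \<le> (1 + expectation (\<lambda>\<omega>. (X \<omega> - a)\<^sup>2)) / (1 + y\<^sup>2)" if "0 \<le> y" for y
      unfolding F_prob using that
      by (intro prob_le_second_moment props(2)) (auto simp: abs_le_square_iff[symmetric])
    show "1 - F (b + y) \<le> (1 + expectation (\<lambda>\<omega>. (X \<omega> - b)\<^sup>2)) / (1 + y\<^sup>2)" if "0 \<le> y" for y
    proof -
      have "1 - F (b + y) = prob {\<omega> \<in> space M. \<not> X \<omega> \<le> b + y}"
        unfolding F_prob by (subst prob_neg) auto
      also have "\<dots> \<le> (1 + expectation (\<lambda>\<omega>. (X \<omega> - b)\<^sup>2)) / (1 + y\<^sup>2)"
        using that by (intro prob_le_second_moment props(2)) (auto simp: abs_le_square_iff[symmetric])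
      finally show ?thesis .
    qed
  qed (rule F_mono F_cont | simp add: F_prob)+
qed

end
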